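(* Let $(R,\mathfrak{m})$ be a commutative local noetherian ring and $\Lambda$ a module-finite $R$-algebra. Then there exists a bijection \[ \operatorname{tors}(\operatorname{fl}\Lambda)\longrightarrow\operatorname{tors}(\Lambda/\mathfrak{m}\Lambda) \] given by $\mathcal{T}\mapsto\mathcal{T}\cap\operatorname{mod}(\Lambda/\mathfrak{m}\Lambda)$.
   Context: A module-finite $R$-algebra is a ring $\Lambda$ with a ring homomorphism $R\to\Lambda$ whose image is in the center of $\Lambda$ such that $\Lambda$ is finitely generated as an $R$-module. $\operatorname{mod}\Gamma$ is the category of finitely generated left $\Gamma$-modules; $\operatorname{fl}\Lambda$ is the category of finite length left $\Lambda$-modules. $\operatorname{mod}(\Lambda/\mathfrak{m}\Lambda)$ is regarded as the full subcategory of $\operatorname{mod}\Lambda$ of modules annihilated by $\mathfrak{m}$. Subcategories are full and closed under isomorphisms. For an abelian category $\mathcal{A}$, a torsion pair is a pair $(\mathcal{T},\mathcal{F})$ of subcategories with $\operatorname{Hom}_{\mathcal{A}}(\mathcal{T},\mathcal{F})=0$ such that each $X\in\mathcal{A}$ admits an exact sequence $0\to X'\to X\to X''\to0$ with $X'\in\mathcal{T}$, $X''\in\mathcal{F}$; then $\mathcal{T}$ is called a torsion class of $\mathcal{A}$. (For $\mathcal{A}=\operatorname{mod}\Gamma$ with $\Gamma$ a module-finite algebra over a noetherian ring, or $\mathcal{A}=\operatorname{fl}\Lambda$, these are exactly the subcategories closed under factor objects and extensions.) $\operatorname{tors}(\operatorname{fl}\Lambda)$ is the set of torsion classes of $\operatorname{fl}\Lambda$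 and $\operatorname{tors}(\Gamma)$ the set of torsion classes of $\operatorname{mod}\Gamma$. *)

theory Defs
  imports "HOL-Algebra.Module" "HOL-Algebra.QuotRing" "HOL-Algebra.Ring_Divisibility"
begin

section \<open>Left modules over a ring\<close>

text \<open>The library locale \<^locale>\<open>module\<close> requires commutative scalars; this is the same
  notion over an arbitrary ring. As there, the multiplicative fields that the record \<open>module\<close>
  inherits from \<open>ring\<close> carry no information.\<close>

locale left_module = R?: ring L + M?: abelian_group M
  for L :: "('l, 'c) ring_scheme" and M :: "('l, 'u, 'd) module_scheme" +
  assumes smult_closed [simp, intro]:
      "\<lbrakk>a \<in> carrier L; x \<in> carrier M\<rbrakk> \<Longrightarrow> a \<odot>\<^bsub>M\<^esub> x \<in> carrier M"
    and smult_l_distr: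
      "\<lbrakk>a \<in> carrier L; b \<in> carrier L; x \<in> carrier M\<rbrakk> \<Longrightarrow>
        (a \<oplus>\<^bsub>L\<^esub> b) \<odot>\<^bsub>M\<^esub> x = a \<odot>\<^bsub>M\<^esub> x \<oplus>\<^bsub>M\<^esub> b \<odot>\<^bsub>M\<^esub> x"
    and smult_r_distr:
      "\<lbrakk>a \<in> carrier L; x \<in> carrier M; y \<in> carrier M\<rbrakk> \<Longrightarrow>
        a \<odot>\<^bsub>M\<^esub> (x \<oplus>\<^bsub>M\<^esub> y) = a \<odot>\<^bsub>M\<^esub> x \<oplus>\<^bsub>M\<^esub> a \<odot>\<^bsub>M\<^esub> y"
    and smult_assoc:
      "\<lbrakk>a \<in> carrier L; b \<in> carrier L; x \<in> carrier M\<rbrakk> \<Longrightarrow>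
        (a \<otimes>\<^bsub>L\<^esub> b) \<odot>\<^bsub>M\<^esub> x = a \<odot>\<^bsub>M\<^esub> (b \<odot>\<^bsub>M\<^esub> x)"
    and smult_one [simp]:
      "x \<in> carrier M \<Longrightarrow> \<one>\<^bsub>L\<^esub> \<odot>\<^bsub>M\<^esub> x = x"

definition module_hom ::
  "('l, 'c) ring_scheme \<Rightarrow> ('l, 'u, 'd) module_scheme \<Rightarrow> ('l, 'v, 'e) module_scheme \<Rightarrow> ('u \<Rightarrow> 'v) set"
  where "module_hom L M N = {f \<in> carrier M \<rightarrow> carrier N.
    (\<forall>x\<in>carrier M. \<forall>y\<in>carrier M. f (x \<oplus>\<^bsub>M\<^esub> y) = f x \<oplus>\<^bsub>N\<^esub> f y) \<and>
    (\<forall>a\<in>carrier L. \<forall>x\<in>carrier M. f (a \<odot>\<^bsub>M\<^esub> x) = a \<odot>\<^bsub>N\<^esub> f x)}"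

definition module_iso ::
  "('l, 'c) ring_scheme \<Rightarrow> ('l, 'u, 'd) module_scheme \<Rightarrow> ('l, 'v, 'e) module_scheme \<Rightarrow> bool"
  where "module_iso L M N \<longleftrightarrow> (\<exists>f\<in>module_hom L M N. bij_betw f (carrier M) (carrier N))"

definition short_exact ::
  "('l, 'c) ring_scheme \<Rightarrow> ('l, 'u, 'd) module_scheme \<Rightarrow> ('l, 'v, 'e) module_scheme
    \<Rightarrow> ('l, 'w, 'g) module_scheme \<Rightarrow> ('u \<Rightarrow> 'v) \<Rightarrow> ('v \<Rightarrow> 'w) \<Rightarrow> bool"
  where "short_exact L X' X X'' f g \<longleftrightarrow>
    f \<in> module_hom L X' X \<and> g \<in> module_hom L X X'' \<and>
    inj_on f (carrier X') \<and> f ` carrier X' = a_kernel X X'' g \<and> g ` carrier X = carrier X''"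

definition finitely_generated :: "('l, 'c) ring_scheme \<Rightarrow> ('l, 'u, 'd) module_scheme \<Rightarrow> bool"
  where "finitely_generated L M \<longleftrightarrow>
    (\<exists>S. finite S \<and> S \<subseteq> carrier M \<and>
      (\<forall>x\<in>carrier M. \<exists>c\<in>S \<rightarrow> carrier L. x = (\<Oplus>\<^bsub>M\<^esub>s\<in>S. c s \<odot>\<^bsub>M\<^esub> s)))"

text \<open>Existence of a composition series; that the \<open>i\<close>-th factor is simple is expressed by
  the absence of submodules strictly between \<open>N i\<close> and \<open>N (Suc i)\<close>.\<close>

definition finite_length :: "('l, 'c) ring_scheme \<Rightarrow> ('l, 'u, 'd) module_scheme \<Rightarrow> bool"
  where "finite_length L M \<longleftrightarrow>
    (\<exists>n (N :: nat \<Rightarrow> 'u set).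
      N 0 = {\<zero>\<^bsub>M\<^esub>} \<and> N n = carrier M \<and> (\<forall>i\<le>n. submodule (N i) L M) \<and>
      (\<forall>i<n. N i \<subset> N (Suc i) \<and>
        \<not> (\<exists>K. submodule K L M \<and> N i \<subset> K \<and> K \<subset> N (Suc i))))"


section \<open>Module-finite algebras over a local ring\<close>

definition local_ring :: "('r, 'c) ring_scheme \<Rightarrow> 'r set \<Rightarrow> bool"
  where "local_ring R m \<longleftrightarrow>
    cring R \<and> maximalideal m R \<and> (\<forall>I. maximalideal I R \<longrightarrow> I = m)"

definition regular_module :: "('l, 'c) ring_scheme \<Rightarrow> ('l, 'l) module"
  where "regular_module L =
    \<lparr>carrier = carrier L, mult = mult L, one = \<one>\<^bsub>L\<^esub>, zero = \<zero>\<^bsub>L\<^esub>, add = add L, smult = mult L\<rparr>"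

definition restrict_scalars :: "('r \<Rightarrow> 'l) \<Rightarrow> ('l, 'u, 'd) module_scheme \<Rightarrow> ('r, 'u) module"
  where "restrict_scalars \<phi> M =
    \<lparr>carrier = carrier M, mult = mult M, one = \<one>\<^bsub>M\<^esub>, zero = \<zero>\<^bsub>M\<^esub>, add = add M,
     smult = (\<lambda>r x. \<phi> r \<odot>\<^bsub>M\<^esub> x)\<rparr>"

definition module_finite_algebra ::
  "('r, 'c) ring_scheme \<Rightarrow> ('l, 'd) ring_scheme \<Rightarrow> ('r \<Rightarrow> 'l) \<Rightarrow> bool"
  where "module_finite_algebra R L \<phi> \<longleftrightarrow>
    ring L \<and> \<phi> \<in> ring_hom R L \<and>
    (\<forall>r\<in>carrier R. \<forall>a\<in>carrier L. \<phi> r \<otimes>\<^bsub>L\<^esub> a = a \<otimes>\<^bsub>L\<^esub> \<phi> r) \<and>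
    finitely_generated R (restrict_scalars \<phi> (regular_module L))"


section \<open>Categories of modules and torsion classes\<close>

text \<open>A full subcategory is given by its set of objects. HOL has no set of all modules, so the
  carriers have to be subsets of one fixed type \<open>'u\<close>. For finitely generated modules over a ring
  with elements of type \<open>'l\<close> the type \<open>(nat \<Rightarrow> 'l) set\<close> is large enough: it contains an
  isomorphic copy of each of them (lemma \<open>finitely_generated_small\<close> below). Modules of finite
  length are finitely generated.\<close>

type_synonym 'l small_module = "('l, (nat \<Rightarrow> 'l) set) module"

definition fg_mod :: "('l, 'c) ring_scheme \<Rightarrow> ('l, 'u) module set"
  where "fg_mod L = {M. left_module L M \<and> finitely_generated L M}"

definition fl_mod :: "('l, 'c) ring_scheme \<Rightarrow> ('l, 'u) module set"
  where "fl_mod L = {M. left_module L M \<and> finite_length L M}"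

text \<open>The category \<open>mod (\<Lambda>/m\<Lambda>)\<close> as a full subcategory of \<open>mod \<Lambda>\<close>. Lemma
  \<open>fg_mod_mod_iff\<close> below identifies it with the image of the restriction of scalars along
  \<open>\<Lambda> \<rightarrow> \<Lambda>/m\<Lambda>\<close>.\<close>

definition fg_mod_mod ::
  "('l, 'c) ring_scheme \<Rightarrow> ('r \<Rightarrow> 'l) \<Rightarrow> 'r set \<Rightarrow> ('l, 'u) module set"
  where "fg_mod_mod L \<phi> m =
    {M \<in> fg_mod L. \<forall>r\<in>m. \<forall>x\<in>carrier M. \<phi> r \<odot>\<^bsub>M\<^esub> x = \<zero>\<^bsub>M\<^esub>}"

definition iso_closed_in ::
  "('l, 'c) ring_scheme \<Rightarrow> ('l, 'u) module set \<Rightarrow> ('l, 'u) module set \<Rightarrow> bool"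
  where "iso_closed_in L A T \<longleftrightarrow> T \<subseteq> A \<and> (\<forall>X\<in>T. \<forall>Y\<in>A. module_iso L X Y \<longrightarrow> Y \<in> T)"

text \<open>The category \<open>A\<close> is meant to be closed under submodules and factor modules, so that
  exactness in \<open>A\<close> is exactness of the underlying sequence of modules.\<close>

definition torsion_pair ::
  "('l, 'c) ring_scheme \<Rightarrow> ('l, 'u) module set \<Rightarrow> ('l, 'u) module set \<Rightarrow> ('l, 'u) module set \<Rightarrow> bool"
  where "torsion_pair L A T F \<longleftrightarrow>
    iso_closed_in L A T \<and> iso_closed_in L A F \<and>
    (\<forall>X\<in>T. \<forall>Y\<in>F. \<forall>f\<in>module_hom L X Y. \<forall>x\<in>carrier X. f x = \<zero>\<^bsub>Y\<^esub>) \<and>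
    (\<forall>X\<in>A. \<exists>X'\<in>T. \<exists>X''\<in>F. \<exists>f g. short_exact L X' X X'' f g)"

definition tors :: "('l, 'c) ring_scheme \<Rightarrow> ('l, 'u) module set \<Rightarrow> ('l, 'u) module set set"
  where "tors L A = {T. \<exists>F. torsion_pair L A T F}"


section \<open>Justification of the encodings\<close>

context left_module
begin

lemma smult_l_null: "x \<in> carrier M \<Longrightarrow> \<zero>\<^bsub>L\<^esub> \<odot>\<^bsub>M\<^esub> x = \<zero>\<^bsub>M\<^esub>"
  using smult_l_distr[of "\<zero>\<^bsub>L\<^esub>" "\<zero>\<^bsub>L\<^esub>" x] by (simp add: M.add.l_cancel_one')

lemma smult_r_null: "a \<in> carrier L \<Longrightarrow> a \<odot>\<^bsub>M\<^esub> \<zero>\<^bsub>M\<^esub> = \<zero>\<^bsub>M\<^esub>"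
  using smult_r_distr[of a "\<zero>\<^bsub>M\<^esub>" "\<zero>\<^bsub>M\<^esub>"] by (simp add: M.add.l_cancel_one')

end

lemma module_hom_zero:
  assumes "left_module L M" "left_module L N" "f \<in> module_hom L M N"
  shows "f \<zero>\<^bsub>M\<^esub> = \<zero>\<^bsub>N\<^esub>"
proof -
  interpret M: left_module L M by fact
  interpret N: left_module L N by fact
  have "f (\<zero>\<^bsub>M\<^esub> \<oplus>\<^bsub>M\<^esub> \<zero>\<^bsub>M\<^esub>) = f \<zero>\<^bsub>M\<^esub> \<oplus>\<^bsub>N\<^esub> f \<zero>\<^bsub>M\<^esub>" "f \<zero>\<^bsub>M\<^esub> \<in> carrier N"
    using assms(3) by (auto simp: module_hom_def simp del: M.M.l_zero M.M.r_zero)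
  then show ?thesis by (simp add: N.M.add.l_cancel_one')
qed

lemma module_hom_finsum:
  assumes "left_module L M" "left_module L N" "f \<in> module_hom L M N"
    and "finite S" "g \<in> S \<rightarrow> carrier M"
  shows "f (\<Oplus>\<^bsub>M\<^esub>s\<in>S. g s) = (\<Oplus>\<^bsub>N\<^esub>s\<in>S. f (g s))"
proof -
  interpret M: left_module L M by fact
  interpret N: left_module L N by fact
  have f: "\<And>x. x \<in> carrier M \<Longrightarrow> f x \<in> carrier N"
    "\<And>x y. x \<in> carrier M \<Longrightarrow> y \<in> carrier M \<Longrightarrow> f (x \<oplus>\<^bsub>M\<^esub> y) = f x \<oplus>\<^bsub>N\<^esub> f y"
    using assms(3) by (auto simp: module_hom_def)
  show ?thesis using assms(4,5)
  proof (induction S)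
    case empty
    then show ?case using module_hom_zero[OF assms(1-3)] by simp
  next
    case (insert a S)
    have g: "g a \<in> carrier M" "g \<in> S \<rightarrow> carrier M" using insert.prems by auto
    have "f (\<Oplus>\<^bsub>M\<^esub>s\<in>insert a S. g s) = f (g a \<oplus>\<^bsub>M\<^esub> (\<Oplus>\<^bsub>M\<^esub>s\<in>S. g s))"
      using insert.hyps g by simp
    also have "\<dots> = f (g a) \<oplus>\<^bsub>N\<^esub> (\<Oplus>\<^bsub>N\<^esub>s\<in>S. f (g s))"
      using f(2)[OF g(1) M.M.finsum_closed[OF g(2)]] insert.IH[OF g(2)] by simp
    also have "\<dots> = (\<Oplus>\<^bsub>N\<^esub>s\<in>insert a S. f (g s))"
      using insert.hyps g f(1) by (subst N.M.finsum_insert) (auto simp: Pi_iff)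
    finally show ?case .
  qed
qed

lemma finitely_generated_iso:
  assumes "left_module L M" "left_module L N" "module_iso L M N" "finitely_generated L M"
  shows "finitely_generated L N"
proof -
  interpret M: left_module L M by fact
  interpret N: left_module L N by fact
  obtain f where f: "f \<in> module_hom L M N" "bij_betw f (carrier M) (carrier N)"
    using assms(3) by (auto simp: module_iso_def)
  obtain S where S: "finite S" "S \<subseteq> carrier M"
    and gen: "\<And>x. x \<in> carrier M \<Longrightarrow> \<exists>c\<in>S \<rightarrow> carrier L. x = (\<Oplus>\<^bsub>M\<^esub>s\<in>S. c s \<odot>\<^bsub>M\<^esub> s)"
    using assms(4) unfolding finitely_generated_def by blast
  have fc: "\<And>x. x \<in> carrier M \<Longrightarrow> f x \<in> carrier N" using f by (auto simp: module_hom_def)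
  have inj: "inj_on f S" using f(2) S(2) by (auto simp: bij_betw_def intro: inj_on_subset)
  show ?thesis unfolding finitely_generated_def
  proof (intro exI[of _ "f ` S"] conjI ballI)
    show "finite (f ` S)" "f ` S \<subseteq> carrier N" using S fc by auto
    fix y assume "y \<in> carrier N"
    then obtain x where x: "x \<in> carrier M" "y = f x" using f(2) by (auto simp: bij_betw_def)
    obtain c where c: "c \<in> S \<rightarrow> carrier L" "x = (\<Oplus>\<^bsub>M\<^esub>s\<in>S. c s \<odot>\<^bsub>M\<^esub> s)"
      using gen[OF x(1)] by blast
    let ?c = "\<lambda>t. c (inv_into S f t)"
    have "y = (\<Oplus>\<^bsub>N\<^esub>s\<in>S. f (c s \<odot>\<^bsub>M\<^esub> s))"
      unfolding x c(2) by (rule module_hom_finsum[OF assms(1,2) f(1) S(1)]) (use c S in auto)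
    also have "\<dots> = (\<Oplus>\<^bsub>N\<^esub>s\<in>S. ?c (f s) \<odot>\<^bsub>N\<^esub> f s)"
    proof (rule N.M.finsum_cong')
      show "(\<lambda>s. ?c (f s) \<odot>\<^bsub>N\<^esub> f s) \<in> S \<rightarrow> carrier N"
        using c S fc inj by (auto simp: Pi_iff subset_iff)
      fix s assume "s \<in> S"
      then show "f (c s \<odot>\<^bsub>M\<^esub> s) = ?c (f s) \<odot>\<^bsub>N\<^esub> f s"
        using c S f inj by (auto simp: module_hom_def Pi_iff subset_iff)
    qed simp
    also have "\<dots> = (\<Oplus>\<^bsub>N\<^esub>t\<in>f ` S. ?c t \<odot>\<^bsub>N\<^esub> t)"
      by (rule N.M.finsum_reindex[symmetric]) (use c S fc inj in \<open>auto simp: Pi_iff subset_iff\<close>)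
    finally have "y = (\<Oplus>\<^bsub>N\<^esub>t\<in>f ` S. ?c t \<odot>\<^bsub>N\<^esub> t)" .
    moreover have "?c \<in> f ` S \<rightarrow> carrier L" using c inj by auto
    ultimately show "\<exists>c\<in>f ` S \<rightarrow> carrier L. y = (\<Oplus>\<^bsub>N\<^esub>t\<in>f ` S. c t \<odot>\<^bsub>N\<^esub> t)" 
      by (rule bexI[of _ ?c])
  qed
qed

lemma module_iso_sym:
  assumes "left_module L M" "module_iso L M N"
  shows "module_iso L N M"
proof -
  interpret M: left_module L M by fact
  obtain f where f: "f \<in> module_hom L M N" "bij_betw f (carrier M) (carrier N)"
    using assms(2) by (auto simp: module_iso_def)
  let ?g = "inv_into (carrier M) f"
  have g: "bij_betw ?g (carrier N) (carrier M)" by (rule bij_betw_inv_into[OF f(2)])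
  have gc: "\<And>y. y \<in> carrier N \<Longrightarrow> ?g y \<in> carrier M" using g by (auto simp: bij_betw_def)
  have fg: "\<And>y. y \<in> carrier N \<Longrightarrow> f (?g y) = y" using f(2) by (rule bij_betw_inv_into_right)
  have gf: "\<And>x. x \<in> carrier M \<Longrightarrow> ?g (f x) = x" using f(2) by (rule bij_betw_inv_into_left)
  have "?g \<in> module_hom L N M"
  proof (unfold module_hom_def, safe)
    fix x y assume xy: "x \<in> carrier N" "y \<in> carrier N"
    have "f (?g x \<oplus>\<^bsub>M\<^esub> ?g y) = x \<oplus>\<^bsub>N\<^esub> y" using f(1) gc fg xy by (auto simp: module_hom_def)
    then show "?g (x \<oplus>\<^bsub>N\<^esub> y) = ?g x \<oplus>\<^bsub>M\<^esub> ?g y" using gf gc xy by (metis M.M.a_closed)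
  next
    fix a x assume ax: "a \<in> carrier L" "x \<in> carrier N"
    have "f (a \<odot>\<^bsub>M\<^esub> ?g x) = a \<odot>\<^bsub>N\<^esub> x" using f(1) gc fg ax by (auto simp: module_hom_def)
    then show "?g (a \<odot>\<^bsub>N\<^esub> x) = a \<odot>\<^bsub>M\<^esub> ?g x" using gf gc ax by (metis M.smult_closed)
  qed (use gc in auto)
  with g show ?thesis by (auto simp: module_iso_def)
qed

lemma transport_module:
  fixes M :: "('l, 'v) module" and e :: "'v \<Rightarrow> 'u"
  assumes "left_module L M" and inj: "inj_on e (carrier M)"
  shows "\<exists>N :: ('l, 'u) module. left_module L N \<and> module_iso L M N"
proof -
  interpret M: left_module L M by fact
  define d where "d = inv_into (carrier M) e"
  have de: "\<And>x. x \<in> carrier M \<Longrightarrow> d (e x) = x" unfolding d_def using inj by simp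
  define N :: "('l, 'u) module" where "N =
    \<lparr>carrier = e ` carrier M, mult = undefined, one = undefined, zero = e \<zero>\<^bsub>M\<^esub>,
     add = (\<lambda>a b. e (d a \<oplus>\<^bsub>M\<^esub> d b)), smult = (\<lambda>r a. e (r \<odot>\<^bsub>M\<^esub> d a))\<rparr>"
  have "abelian_group N"
  proof (rule abelian_groupI)
    fix x assume "x \<in> carrier N"
    then obtain x' where "x' \<in> carrier M" "x = e x'" by (auto simp: N_def)
    then show "\<exists>y\<in>carrier N. y \<oplus>\<^bsub>N\<^esub> x = \<zero>\<^bsub>N\<^esub>"
      by (intro bexI[of _ "e (\<ominus>\<^bsub>M\<^esub> x')"]) (auto simp: N_def de M.M.l_neg)
  next
    fix x y assume "x \<in> carrier N" "y \<in> carrier N"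
    then show "x \<oplus>\<^bsub>N\<^esub> y = y \<oplus>\<^bsub>N\<^esub> x" by (auto simp: N_def de intro: arg_cong[OF M.M.a_comm])
  qed (auto simp: N_def de M.M.a_assoc)
  then have "left_module L N"
    using M.R.ring_axioms
    by (intro left_module.intro left_module_axioms.intro)
       (auto simp: N_def de M.smult_l_distr M.smult_r_distr M.smult_assoc)
  moreover have "module_iso L M N"
    unfolding module_iso_def module_hom_def using inj
    by (intro bexI[of _ e]) (auto simp: N_def de bij_betw_def)
  ultimately show ?thesis by blast
qed

lemma finitely_generated_small:
  fixes M :: "('l, 'v) module"
  assumes "left_module L M" and "finitely_generated L M"
  shows "\<exists>N :: 'l small_module. N \<in> fg_mod L \<and> module_iso L M N"
proof -
  obtain S where S: "finite S" "S \<subseteq> carrier M"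
    and gen: "\<And>x. x \<in> carrier M \<Longrightarrow> \<exists>c\<in>S \<rightarrow> carrier L. x = (\<Oplus>\<^bsub>M\<^esub>s\<in>S. c s \<odot>\<^bsub>M\<^esub> s)"
    using assms(2) unfolding finitely_generated_def by blast
  interpret M: left_module L M by fact
  obtain h :: "'v \<Rightarrow> nat" where h: "inj_on h S"
    using finite_imp_inj_to_nat_seg[OF S(1)] by blast
  define e where "e x = {c :: nat \<Rightarrow> 'l. (\<Oplus>\<^bsub>M\<^esub>s\<in>S. c (h s) \<odot>\<^bsub>M\<^esub> s) = x}" for x
  have "e x \<noteq> {}" if x: "x \<in> carrier M" for x
  proof -
    obtain c where c: "c \<in> S \<rightarrow> carrier L" "x = (\<Oplus>\<^bsub>M\<^esub>s\<in>S. c s \<odot>\<^bsub>M\<^esub> s)"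
      using gen[OF x] by blast
    have "(\<Oplus>\<^bsub>M\<^esub>s\<in>S. c (inv_into S h (h s)) \<odot>\<^bsub>M\<^esub> s) = (\<Oplus>\<^bsub>M\<^esub>s\<in>S. c s \<odot>\<^bsub>M\<^esub> s)"
      by (rule M.M.finsum_cong') (use c S h in auto)
    then have "(\<lambda>i. c (inv_into S h i)) \<in> e x" unfolding e_def c(2) by simp
    then show ?thesis by blast
  qed
  then have "inj_on e (carrier M)" by (intro inj_onI) (force simp: e_def)
  then obtain N :: "'l small_module" where "left_module L N" "module_iso L M N"
    using transport_module[OF assms(1)] by blast
  then show ?thesis
    using finitely_generated_iso[OF assms(1) _ _ assms(2)] by (auto simp: fg_mod_def)
qed

lemma finsum_same:
  assumes "carrier M = carrier N" "add M = add N" "\<zero>\<^bsub>M\<^esub> = \<zero>\<^bsub>N\<^esub>"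
  shows "finsum M g S = finsum N g S"
  using assms by (simp add: finsum_def finprod_def)

lemma abelian_group_same:
  assumes "abelian_group M" "carrier N = carrier M" "add N = add M" "\<zero>\<^bsub>N\<^esub> = \<zero>\<^bsub>M\<^esub>"
  shows "abelian_group N"
proof -
  interpret M: abelian_group M by fact
  show ?thesis
  proof (rule abelian_groupI)
    fix x assume "x \<in> carrier N"
    then show "\<exists>y\<in>carrier N. y \<oplus>\<^bsub>N\<^esub> x = \<zero>\<^bsub>N\<^esub>"
      using M.l_neg M.a_inv_closed assms(2-4) by metis
  next
    fix x y assume "x \<in> carrier N" "y \<in> carrier N"
    then show "x \<oplus>\<^bsub>N\<^esub> y = y \<oplus>\<^bsub>N\<^esub> x" by (simp add: assms M.a_comm)
  qed (simp_all add: assms M.a_assoc)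
qed

lemma restrict_scalars_left_module:
  assumes "ring L" "\<pi> \<in> ring_hom L K" "left_module K N"
  shows "left_module L (restrict_scalars \<pi> N)"
proof -
  interpret N: left_module K N by fact
  have "abelian_group (restrict_scalars \<pi> N)"
    by (rule abelian_group_same[OF N.M.abelian_group_axioms]) (simp_all add: restrict_scalars_def)
  with assms show ?thesis
    by (intro left_module.intro left_module_axioms.intro)
       (auto simp: restrict_scalars_def ring_hom_memE[OF assms(2)]
         N.smult_l_distr N.smult_r_distr N.smult_assoc)
qed

text \<open>As the image of \<open>\<phi>\<close> is central, \<open>m\<Lambda>\<close> is the two-sided ideal of \<open>\<Lambda>\<close> generated by the
  image of \<open>m\<close>.\<close>

lemma fg_mod_mod_iff:
  fixes M :: "('l, 'u) module"
  assumes "module_finite_algebra R L \<phi>" and "ideal m R"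
  defines "J \<equiv> Idl\<^bsub>L\<^esub> (\<phi> ` m)"
  shows "M \<in> fg_mod_mod L \<phi> m \<longleftrightarrow>
    left_module L M \<and>
    (\<exists>N :: ('l set, 'u) module. N \<in> fg_mod (L Quot J) \<and>
       module_iso L M (restrict_scalars ((+>\<^bsub>L\<^esub>) J) N))"
proof -
  interpret L: ring L using assms(1) by (simp add: module_finite_algebra_def)
  have phi: "\<phi> ` m \<subseteq> carrier L"
    using assms(1) additive_subgroup.a_subset[OF ideal.axioms(1)[OF assms(2)]]
    by (auto simp: module_finite_algebra_def dest: ring_hom_closed)
  interpret J: ideal J L unfolding J_def by (rule L.genideal_ideal[OF phi])
  note hom = ring_hom_memE[OF J.rcos_ring_hom]
  have phiJ: "\<phi> r \<in> J" if "r \<in> m" for r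
    using L.genideal_self[OF phi] that by (auto simp: J_def)
  have surj: "\<exists>a\<in>carrier L. C = J +>\<^bsub>L\<^esub> a" if "C \<in> carrier (L Quot J)" for C
    using that by (auto simp: FactRing_def A_RCOSETS_def')
  show ?thesis
  proof (intro iffI conjI)
    assume "M \<in> fg_mod_mod L \<phi> m"
    then have M: "left_module L M" "finitely_generated L M"
      and ann: "\<And>r x. r \<in> m \<Longrightarrow> x \<in> carrier M \<Longrightarrow> \<phi> r \<odot>\<^bsub>M\<^esub> x = \<zero>\<^bsub>M\<^esub>"
      by (auto simp: fg_mod_mod_def fg_mod_def)
    show "left_module L M" by fact
    interpret M: left_module L M by fact
    define A where "A = {a \<in> carrier L. \<forall>x\<in>carrier M. a \<odot>\<^bsub>M\<^esub> x = \<zero>\<^bsub>M\<^esub>}"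
    have neg: "(\<ominus>\<^bsub>L\<^esub> a) \<odot>\<^bsub>M\<^esub> x = \<zero>\<^bsub>M\<^esub>"
      if "a \<in> A" "x \<in> carrier M" for a x
      using M.smult_l_distr[of "\<ominus>\<^bsub>L\<^esub> a" a x] that
      by (simp add: A_def L.l_neg M.smult_l_null)
    have "ideal A L"
    proof (rule idealI[OF L.ring_axioms])
      show "subgroup A (add_monoid L)"
      proof (rule L.add.subgroupI)
        show "A \<noteq> {}" using M.smult_l_null by (auto simp: A_def intro!: exI[of _ "\<zero>\<^bsub>L\<^esub>"])
        show "\<ominus>\<^bsub>L\<^esub> a \<in> A" if "a \<in> A" for a using neg[OF that] that by (auto simp: A_def)
      qed (auto simp: A_def M.smult_l_distr)
    qed (auto simp: A_def M.smult_assoc M.smult_r_null)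
    moreover have "\<phi> ` m \<subseteq> A" using phi ann by (auto simp: A_def)
    ultimately have JA: "J \<subseteq> A" unfolding J_def by (rule L.genideal_minimal)
    define N :: "('l set, 'u) module" where "N =
      \<lparr>carrier = carrier M, mult = mult M, one = \<one>\<^bsub>M\<^esub>, zero = \<zero>\<^bsub>M\<^esub>, add = add M,
       smult = (\<lambda>C x. (SOME a. a \<in> C) \<odot>\<^bsub>M\<^esub> x)\<rparr>"
    have smult: "(J +>\<^bsub>L\<^esub> a) \<odot>\<^bsub>N\<^esub> x = a \<odot>\<^bsub>M\<^esub> x" if a: "a \<in> carrier L" "x \<in> carrier M" for a x
    proof -
      have "(SOME b. b \<in> J +>\<^bsub>L\<^esub> a) \<in> J +>\<^bsub>L\<^esub> a"
        by (rule someI) (rule J.a_rcos_self[OF a(1)])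
      then obtain j where j: "j \<in> J" "(SOME b. b \<in> J +>\<^bsub>L\<^esub> a) = j \<oplus>\<^bsub>L\<^esub> a"
        by (auto simp: a_r_coset_def')
      with JA a show ?thesis by (auto simp: N_def A_def M.smult_l_distr)
    qed
    have N: "carrier N = carrier M" "add N = add M" "\<zero>\<^bsub>N\<^esub> = \<zero>\<^bsub>M\<^esub>" by (simp_all add: N_def)
    have "abelian_group N"
      by (rule abelian_group_same[OF M.M.abelian_group_axioms]) (simp_all add: N)
    moreover have "left_module_axioms (L Quot J) N"
    proof
      fix a x assume "a \<in> carrier (L Quot J)" "x \<in> carrier N"
      then show "a \<odot>\<^bsub>N\<^esub> x \<in> carrier N" using surj[of a] smult by (auto simp: N)
    next
      fix a b x assume "a \<in> carrier (L Quot J)" "b \<in> carrier (L Quot J)" "x \<in> carrier N"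
      then show "(a \<oplus>\<^bsub>L Quot J\<^esub> b) \<odot>\<^bsub>N\<^esub> x = a \<odot>\<^bsub>N\<^esub> x \<oplus>\<^bsub>N\<^esub> b \<odot>\<^bsub>N\<^esub> x"
        and "(a \<otimes>\<^bsub>L Quot J\<^esub> b) \<odot>\<^bsub>N\<^esub> x = a \<odot>\<^bsub>N\<^esub> (b \<odot>\<^bsub>N\<^esub> x)"
        using surj[of a] surj[of b]
        by (auto simp: N smult M.smult_l_distr M.smult_assoc hom(2,3)[symmetric])
    next
      fix a x y assume "a \<in> carrier (L Quot J)" "x \<in> carrier N" "y \<in> carrier N"
      then show "a \<odot>\<^bsub>N\<^esub> (x \<oplus>\<^bsub>N\<^esub> y) = a \<odot>\<^bsub>N\<^esub> x \<oplus>\<^bsub>N\<^esub> a \<odot>\<^bsub>N\<^esub> y"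
        using surj[of a] by (auto simp: N smult M.smult_r_distr)
    next
      fix x assume "x \<in> carrier N"
      then show "\<one>\<^bsub>L Quot J\<^esub> \<odot>\<^bsub>N\<^esub> x = x" by (simp add: N smult hom(4)[symmetric])
    qed
    ultimately have lN: "left_module (L Quot J) N"
      using J.quotient_is_ring by (intro left_module.intro)
    obtain S where S: "finite S" "S \<subseteq> carrier M"
      and gen: "\<And>x. x \<in> carrier M \<Longrightarrow> \<exists>c\<in>S \<rightarrow> carrier L. x = (\<Oplus>\<^bsub>M\<^esub>s\<in>S. c s \<odot>\<^bsub>M\<^esub> s)"
      using M(2) unfolding finitely_generated_def by blast
    have "finitely_generated (L Quot J) N" unfolding finitely_generated_def
    proof (intro exI[of _ S] conjI ballI)
      fix x assume "x \<in> carrier N"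
      then obtain c where c: "c \<in> S \<rightarrow> carrier L" "x = (\<Oplus>\<^bsub>M\<^esub>s\<in>S. c s \<odot>\<^bsub>M\<^esub> s)"
        using gen by (auto simp: N)
      have "(\<Oplus>\<^bsub>N\<^esub>s\<in>S. (J +>\<^bsub>L\<^esub> c s) \<odot>\<^bsub>N\<^esub> s) = (\<Oplus>\<^bsub>M\<^esub>s\<in>S. (J +>\<^bsub>L\<^esub> c s) \<odot>\<^bsub>N\<^esub> s)"
        by (rule finsum_same) (simp_all add: N)
      also have "\<dots> = x" unfolding c(2)
        by (rule M.M.finsum_cong') (use c S smult in \<open>auto simp: subset_iff Pi_iff\<close>)
      finally show "\<exists>c\<in>S \<rightarrow> carrier (L Quot J). x = (\<Oplus>\<^bsub>N\<^esub>s\<in>S. c s \<odot>\<^bsub>N\<^esub> s)"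
        using c(1) hom(1) by (intro bexI[of _ "\<lambda>s. J +>\<^bsub>L\<^esub> c s"]) auto
    qed (use S in \<open>auto simp: N\<close>)
    moreover have "module_iso L M (restrict_scalars ((+>\<^bsub>L\<^esub>) J) N)"
      unfolding module_iso_def module_hom_def
      by (intro bexI[of _ "\<lambda>x. x"]) (auto simp: restrict_scalars_def N smult bij_betw_def)
    ultimately show "\<exists>N :: ('l set, 'u) module. N \<in> fg_mod (L Quot J) \<and>
       module_iso L M (restrict_scalars ((+>\<^bsub>L\<^esub>) J) N)"
      using lN by (auto simp: fg_mod_def)
  next
    assume "left_module L M \<and> (\<exists>N :: ('l set, 'u) module. N \<in> fg_mod (L Quot J) \<and>
       module_iso L M (restrict_scalars ((+>\<^bsub>L\<^esub>) J) N))"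
    then obtain N :: "('l set, 'u) module" where M: "left_module L M"
      and N: "left_module (L Quot J) N" "finitely_generated (L Quot J) N"
      and iso: "module_iso L M (restrict_scalars ((+>\<^bsub>L\<^esub>) J) N)"
      by (auto simp: fg_mod_def)
    interpret M: left_module L M by fact
    interpret N: left_module "L Quot J" N by fact
    let ?N = "restrict_scalars ((+>\<^bsub>L\<^esub>) J) N"
    have lN: "left_module L ?N"
      by (rule restrict_scalars_left_module[OF L.ring_axioms J.rcos_ring_hom N(1)])
    interpret N': left_module L ?N by fact
    have [simp]: "carrier ?N = carrier N" "\<zero>\<^bsub>?N\<^esub> = \<zero>\<^bsub>N\<^esub>" "add ?N = add N"
      "a \<odot>\<^bsub>?N\<^esub> x = (J +>\<^bsub>L\<^esub> a) \<odot>\<^bsub>N\<^esub> x" for a x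
      by (simp_all add: restrict_scalars_def)
    obtain S where S: "finite S" "S \<subseteq> carrier N"
      and gen: "\<And>x. x \<in> carrier N \<Longrightarrow>
        \<exists>c\<in>S \<rightarrow> carrier (L Quot J). x = (\<Oplus>\<^bsub>N\<^esub>s\<in>S. c s \<odot>\<^bsub>N\<^esub> s)"
      using N(2) unfolding finitely_generated_def by blast
    have "finitely_generated L ?N" unfolding finitely_generated_def
    proof (intro exI[of _ S] conjI ballI)
      fix x assume "x \<in> carrier ?N"
      then obtain c where c: "c \<in> S \<rightarrow> carrier (L Quot J)" "x = (\<Oplus>\<^bsub>N\<^esub>s\<in>S. c s \<odot>\<^bsub>N\<^esub> s)"
        using gen by auto
      have "\<forall>s\<in>S. \<exists>a. a \<in> carrier L \<and> c s = J +>\<^bsub>L\<^esub> a" 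
        using surj c(1) by (metis PiE)
      then obtain b where b: "\<forall>s\<in>S. b s \<in> carrier L \<and> c s = J +>\<^bsub>L\<^esub> b s" by metis
      have "(\<Oplus>\<^bsub>?N\<^esub>s\<in>S. b s \<odot>\<^bsub>?N\<^esub> s) = (\<Oplus>\<^bsub>N\<^esub>s\<in>S. b s \<odot>\<^bsub>?N\<^esub> s)"
        by (rule finsum_same) simp_all
      also have "\<dots> = x" unfolding c(2)
        by (rule N.M.finsum_cong') (use b c S in \<open>auto simp: subset_iff Pi_iff\<close>)
      finally show "\<exists>c\<in>S \<rightarrow> carrier L. x = (\<Oplus>\<^bsub>?N\<^esub>s\<in>S. c s \<odot>\<^bsub>?N\<^esub> s)"
        using b by (intro bexI[of _ b]) auto
    qed (use S in auto)
    then have fgM: "finitely_generated L M"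
      using finitely_generated_iso[OF lN M module_iso_sym[OF M iso]] by blast
    obtain f where f: "f \<in> module_hom L M ?N" "bij_betw f (carrier M) (carrier ?N)"
      using iso by (auto simp: module_iso_def)
    have "\<phi> r \<odot>\<^bsub>M\<^esub> x = \<zero>\<^bsub>M\<^esub>" if rx: "r \<in> m" "x \<in> carrier M" for r x
    proof -
      have pr: "\<phi> r \<in> carrier L" using phi rx by auto
      have fx: "f x \<in> carrier N" using f rx by (auto simp: module_hom_def)
      have "f (\<phi> r \<odot>\<^bsub>M\<^esub> x) = (J +>\<^bsub>L\<^esub> \<phi> r) \<odot>\<^bsub>N\<^esub> f x"
        using f(1) pr rx by (auto simp: module_hom_def)
      also have "J +>\<^bsub>L\<^esub> \<phi> r = \<zero>\<^bsub>L Quot J\<^esub>"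
        using J.a_rcos_const[OF phiJ[OF rx(1)]] by (simp add: FactRing_def)
      also have "\<dots> \<odot>\<^bsub>N\<^esub> f x = f \<zero>\<^bsub>M\<^esub>"
        using N.smult_l_null[OF fx] module_hom_zero[OF M lN f(1)] by simp
      finally show ?thesis
        using f(2) pr rx by (auto simp: bij_betw_def dest: inj_onD)
    qed
    with M fgM show "M \<in> fg_mod_mod L \<phi> m" by (auto simp: fg_mod_mod_def fg_mod_def)
  qed
qed

end

theory Submission
  imports Defs
begin

text \<open>
  A torsion class \<open>T\<close> of a category \<open>A\<close> is recovered from its torsion-free class \<open>F\<close> as the class
  of all \<open>X\<close> in \<open>A\<close> without non-zero homomorphisms to objects of \<open>F\<close> (\<open>torsion_class_iff\<close>).
  The whole comparison of \<open>fl \<Lambda>\<close> with \<open>mod (\<Lambda>/m\<Lambda>)\<close> therefore reduces to the vanishing of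
  homomorphisms, and rests on one observation (\<open>nonzero_hom_with_annihilated_image\<close>): if there is a
  non-zero homomorphism \<open>f : X \<rightarrow> Y\<close> into a module of finite length, then there is a non-zero
  \<open>g : X \<rightarrow> Y\<close> whose image is annihilated by \<open>m\<close>. Indeed, take \<open>g\<close> non-zero with image \<open>Z\<close> as small
  as possible. For \<open>t \<in> m\<close> the map \<open>t g\<close> is again a homomorphism, as \<open>t\<close> acts centrally, and its
  image \<open>tZ\<close> lies in \<open>Z\<close>; so \<open>t g = 0\<close> or \<open>tZ = Z\<close>. The latter is excluded by Nakayama's lemma
  over \<open>R\<close> (\<open>nakayama_local\<close>), because \<open>Z\<close> is finitely generated over \<open>R\<close>.

  Restriction. Since \<open>mod (\<Lambda>/m\<Lambda>)\<close> is contained in \<open>fl \<Lambda>\<close> and closed under submodules and factor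
  modules, a torsion pair of \<open>fl \<Lambda>\<close> restricts to one of \<open>mod (\<Lambda>/m\<Lambda>)\<close>.

  Injectivity. Let \<open>X\<close> be in a torsion class \<open>T\<^sub>1\<close> and let \<open>T\<^sub>1 \<inter> mod (\<Lambda>/m\<Lambda>)\<close> be contained in
  the torsion class \<open>T\<^sub>2\<close> with torsion-free class \<open>F\<^sub>2\<close>. A non-zero homomorphism from \<open>X\<close> to some
  \<open>Y\<close> in \<open>F\<^sub>2\<close> could be replaced by one whose image \<open>Z\<close> is annihilated by \<open>m\<close>. Then \<open>Z\<close>, being a
  factor module of \<open>X\<close>, lies in \<open>T\<^sub>1\<close>, hence in \<open>T\<^sub>2\<close>, and the inclusion of \<open>Z\<close> in \<open>Y\<close> has to
  vanish. So \<open>X\<close> is in \<open>T\<^sub>2\<close>.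

  Surjectivity. A torsion pair \<open>(T, F)\<close> of \<open>mod (\<Lambda>/m\<Lambda>)\<close> extends to the pair formed by the \<open>X\<close> in
  \<open>fl \<Lambda>\<close> with \<open>Hom(X, F) = 0\<close> and the \<open>Y\<close> in \<open>fl \<Lambda>\<close> with \<open>Hom(T, Y) = 0\<close>. Homomorphisms between
  the two classes vanish by the same argument as before. The torsion submodule \<open>U\<close> of \<open>X\<close> is the sum
  of all submodules \<open>V\<close> with \<open>Hom(V, F) = 0\<close>: a homomorphism from an object of \<open>T\<close> to \<open>X/U\<close> has an
  image of the form \<open>V/U\<close>, and \<open>Hom(V, F) = 0\<close> forces \<open>V = U\<close>.

  Finite length is handled through rank functions, that is, strictly monotone maps from the
  submodules to the natural numbers (\<open>finite_length_iff_rank\<close>). These pass directly to submodules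
  and factor modules.
\<close>

section \<open>Submodules, images and quotients\<close>

context left_module
begin

lemma smult_minus_one:
  assumes "x \<in> carrier M"
  shows "(\<ominus>\<^bsub>L\<^esub> \<one>\<^bsub>L\<^esub>) \<odot>\<^bsub>M\<^esub> x = \<ominus>\<^bsub>M\<^esub> x"
proof -
  have "(\<ominus>\<^bsub>L\<^esub> \<one>\<^bsub>L\<^esub>) \<odot>\<^bsub>M\<^esub> x \<oplus>\<^bsub>M\<^esub> x = \<zero>\<^bsub>M\<^esub>"
    using smult_l_distr[of "\<ominus>\<^bsub>L\<^esub> \<one>\<^bsub>L\<^esub>" "\<one>\<^bsub>L\<^esub>" x] assms by (simp add: R.l_neg smult_l_null)
  then show ?thesis using assms by (intro M.minus_equality[symmetric]) auto
qed

lemma submodule_iff: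
  "submodule H L M \<longleftrightarrow> H \<subseteq> carrier M \<and> \<zero>\<^bsub>M\<^esub> \<in> H \<and> (\<forall>x\<in>H. \<forall>y\<in>H. x \<oplus>\<^bsub>M\<^esub> y \<in> H) \<and>
    (\<forall>a\<in>carrier L. \<forall>x\<in>H. a \<odot>\<^bsub>M\<^esub> x \<in> H)" (is "?l \<longleftrightarrow> ?r")
proof
  assume ?l
  then interpret H: submodule H L M .
  show ?r using H.subset H.one_closed H.m_closed by auto
next
  assume r: ?r
  have "\<ominus>\<^bsub>M\<^esub> x \<in> H" if "x \<in> H" for x
  proof -
    have "(\<ominus>\<^bsub>L\<^esub> \<one>\<^bsub>L\<^esub>) \<odot>\<^bsub>M\<^esub> x \<in> H" using r that by blast
    moreover have "x \<in> carrier M" using r that by blast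
    ultimately show ?thesis by (simp add: smult_minus_one)
  qed
  with r show ?l
    by (intro submodule.intro subgroup.intro submodule_axioms.intro)
       (auto simp: a_inv_def[symmetric])
qed

lemma submodule_minus:
  assumes "submodule H L M" "x \<in> H" "y \<in> H"
  shows "x \<ominus>\<^bsub>M\<^esub> y \<in> H"
proof -
  have "(\<ominus>\<^bsub>L\<^esub> \<one>\<^bsub>L\<^esub>) \<odot>\<^bsub>M\<^esub> y \<in> H" using assms by (auto simp: submodule_iff)
  moreover have "y \<in> carrier M" using assms by (auto simp: submodule_iff)
  ultimately have "\<ominus>\<^bsub>M\<^esub> y \<in> H" by (simp add: smult_minus_one)
  with assms show ?thesis by (auto simp: submodule_iff M.minus_eq)
qed

lemma submodule_carrier: "submodule (carrier M) L M"
  by (simp add: submodule_iff)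

lemma submodule_zero: "submodule {\<zero>\<^bsub>M\<^esub>} L M"
  by (simp add: submodule_iff smult_r_null)

lemma submodule_Int: "submodule H L M \<Longrightarrow> submodule K L M \<Longrightarrow> submodule (H \<inter> K) L M"
  by (auto simp: submodule_iff)

lemma submodule_finsum:
  assumes "submodule H L M" "finite S" "g \<in> S \<rightarrow> H"
  shows "(\<Oplus>\<^bsub>M\<^esub>s\<in>S. g s) \<in> H"
  using assms(2,3)
proof (induction S)
  case empty
  then show ?case using assms(1) by (simp add: submodule_iff)
next
  case (insert a S)
  then have "g \<in> S \<rightarrow> carrier M" "g a \<in> carrier M" "g a \<in> H" "(\<Oplus>\<^bsub>M\<^esub>s\<in>S. g s) \<in> H"
    using assms(1) by (auto simp: submodule_iff)
  then show ?case using insert.hyps assms(1) by (simp add: submodule_iff)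
qed

lemma submodule_left_module:
  assumes "submodule H L M"
  shows "left_module L (M\<lparr>carrier := H\<rparr>)"
proof -
  have H: "H \<subseteq> carrier M" "\<zero>\<^bsub>M\<^esub> \<in> H" "\<And>x y. x \<in> H \<Longrightarrow> y \<in> H \<Longrightarrow> x \<oplus>\<^bsub>M\<^esub> y \<in> H"
    "\<And>a x. a \<in> carrier L \<Longrightarrow> x \<in> H \<Longrightarrow> a \<odot>\<^bsub>M\<^esub> x \<in> H"
    using assms by (auto simp: submodule_iff)
  have "abelian_group (M\<lparr>carrier := H\<rparr>)"
  proof (rule abelian_groupI)
    fix x assume "x \<in> carrier (M\<lparr>carrier := H\<rparr>)"
    then have x: "x \<in> H" "x \<in> carrier M" using H by auto
    have "\<ominus>\<^bsub>M\<^esub> x \<in> H" using H(4)[of "\<ominus>\<^bsub>L\<^esub> \<one>\<^bsub>L\<^esub>" x] x by (simp add: smult_minus_one)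
    then show "\<exists>y\<in>carrier (M\<lparr>carrier := H\<rparr>). y \<oplus>\<^bsub>M\<lparr>carrier := H\<rparr>\<^esub> x = \<zero>\<^bsub>M\<lparr>carrier := H\<rparr>\<^esub>"
      using x by (auto intro!: bexI[of _ "\<ominus>\<^bsub>M\<^esub> x"] simp: M.l_neg)
  next
    fix x y assume "x \<in> carrier (M\<lparr>carrier := H\<rparr>)" "y \<in> carrier (M\<lparr>carrier := H\<rparr>)"
    then show "x \<oplus>\<^bsub>M\<lparr>carrier := H\<rparr>\<^esub> y = y \<oplus>\<^bsub>M\<lparr>carrier := H\<rparr>\<^esub> x"
      using H M.a_comm[of x y] by auto
  qed (use H in \<open>auto simp: subset_iff M.a_assoc\<close>)
  then show ?thesis
    using H by (intro left_module.intro left_module_axioms.intro R.ring_axioms)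
      (auto simp: subset_iff smult_l_distr smult_r_distr smult_assoc)
qed

lemma submodule_trans_iff:
  assumes "submodule H L M"
  shows "submodule K L (M\<lparr>carrier := H\<rparr>) \<longleftrightarrow> submodule K L M \<and> K \<subseteq> H"
proof -
  interpret H: left_module L "M\<lparr>carrier := H\<rparr>" by (rule submodule_left_module[OF assms])
  show ?thesis using assms by (auto simp: submodule_iff H.submodule_iff)
qed

end

lemma module_homD:
  assumes "f \<in> module_hom L M N"
  shows "x \<in> carrier M \<Longrightarrow> f x \<in> carrier N"
    and "x \<in> carrier M \<Longrightarrow> y \<in> carrier M \<Longrightarrow> f (x \<oplus>\<^bsub>M\<^esub> y) = f x \<oplus>\<^bsub>N\<^esub> f y"
    and "a \<in> carrier L \<Longrightarrow> x \<in> carrier M \<Longrightarrow> f (a \<odot>\<^bsub>M\<^esub> x) = a \<odot>\<^bsub>N\<^esub> f x"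
  using assms by (auto simp: module_hom_def)

lemma module_hom_compose:
  assumes "f \<in> module_hom L M N" "g \<in> module_hom L N P"
  shows "(\<lambda>x. g (f x)) \<in> module_hom L M P"
  using assms by (auto simp: module_hom_def Pi_iff)

lemma module_hom_inclusion:
  "H \<subseteq> carrier M \<Longrightarrow> (\<lambda>x. x) \<in> module_hom L (M\<lparr>carrier := H\<rparr>) M"
  by (auto simp: module_hom_def)

lemma module_hom_restrict:
  "f \<in> module_hom L M N \<Longrightarrow> H \<subseteq> carrier M \<Longrightarrow> f \<in> module_hom L (M\<lparr>carrier := H\<rparr>) N"
  by (auto simp: module_hom_def Pi_iff subset_iff)

lemma module_hom_corestrict:
  "f \<in> module_hom L M N \<Longrightarrow> f ` carrier M \<subseteq> H \<Longrightarrow> f \<in> module_hom L M (N\<lparr>carrier := H\<rparr>)"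
  by (auto simp: module_hom_def Pi_iff image_subset_iff)

lemma module_hom_minus:
  assumes "left_module L M" "left_module L N" "f \<in> module_hom L M N"
    and "x \<in> carrier M" "y \<in> carrier M"
  shows "f (x \<ominus>\<^bsub>M\<^esub> y) = f x \<ominus>\<^bsub>N\<^esub> f y"
proof -
  interpret M: left_module L M by fact
  interpret N: left_module L N by fact
  note f = module_homD[OF assms(3)]
  show ?thesis
    using f(2)[of x "\<ominus>\<^bsub>M\<^esub> y"] f(3)[of "\<ominus>\<^bsub>L\<^esub> \<one>\<^bsub>L\<^esub>" y] assms(4,5) f(1)
    by (simp add: M.smult_minus_one N.smult_minus_one M.M.minus_eq N.M.minus_eq)
qed

lemma submodule_vimage:
  assumes "left_module L M" "left_module L N" "f \<in> module_hom L M N" "submodule K L N"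
  shows "submodule {x \<in> carrier M. f x \<in> K} L M"
proof -
  interpret M: left_module L M by fact
  interpret N: left_module L N by fact
  show ?thesis
    using assms(4) module_hom_zero[OF assms(1-3)]
    by (auto simp: M.submodule_iff N.submodule_iff module_homD[OF assms(3)])
qed

lemma submodule_image:
  assumes "left_module L M" "left_module L N" "f \<in> module_hom L M N" "submodule H L M"
  shows "submodule (f ` H) L N"
proof -
  interpret M: left_module L M by fact
  interpret N: left_module L N by fact
  note f = module_homD[OF assms(3)]
  have H: "H \<subseteq> carrier M" "\<zero>\<^bsub>M\<^esub> \<in> H" "\<And>x y. x \<in> H \<Longrightarrow> y \<in> H \<Longrightarrow> x \<oplus>\<^bsub>M\<^esub> y \<in> H"
    "\<And>a x. a \<in> carrier L \<Longrightarrow> x \<in> H \<Longrightarrow> a \<odot>\<^bsub>M\<^esub> x \<in> H"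
    using assms(4) by (auto simp: M.submodule_iff)
  have "f x \<oplus>\<^bsub>N\<^esub> f y \<in> f ` H" if "x \<in> H" "y \<in> H" for x y
    using f(2)[of x y] H that by (metis image_eqI subsetD)
  moreover have "a \<odot>\<^bsub>N\<^esub> f x \<in> f ` H" if "a \<in> carrier L" "x \<in> H" for a x
    using f(3)[of a x] H that by (metis image_eqI subsetD)
  moreover have "\<zero>\<^bsub>N\<^esub> \<in> f ` H" using module_hom_zero[OF assms(1-3)] H by force
  ultimately show ?thesis using H f(1) by (auto simp: N.submodule_iff)
qed

lemma left_module_image:
  fixes M :: "('l, 'u, 'd) module_scheme" and Q :: "('l, 'v, 'e) module_scheme"
  assumes "left_module L M" "p ` carrier M = carrier Q" "p \<zero>\<^bsub>M\<^esub> = \<zero>\<^bsub>Q\<^esub>"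
    and add: "\<And>x y. x \<in> carrier M \<Longrightarrow> y \<in> carrier M \<Longrightarrow> p x \<oplus>\<^bsub>Q\<^esub> p y = p (x \<oplus>\<^bsub>M\<^esub> y)"
    and smult: "\<And>a x. a \<in> carrier L \<Longrightarrow> x \<in> carrier M \<Longrightarrow> a \<odot>\<^bsub>Q\<^esub> p x = p (a \<odot>\<^bsub>M\<^esub> x)"
  shows "left_module L Q"
proof -
  interpret M: left_module L M by fact
  have Q: "carrier Q = p ` carrier M" "\<zero>\<^bsub>Q\<^esub> = p \<zero>\<^bsub>M\<^esub>" using assms(2,3) by auto
  have "abelian_group Q"
  proof (rule abelian_groupI)
    fix z assume "z \<in> carrier Q"
    then obtain x where "x \<in> carrier M" "z = p x" by (auto simp: Q)
    then show "\<exists>y\<in>carrier Q. y \<oplus>\<^bsub>Q\<^esub> z = \<zero>\<^bsub>Q\<^esub>"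
      by (intro bexI[of _ "p (\<ominus>\<^bsub>M\<^esub> x)"]) (auto simp: Q add M.M.l_neg)
  next
    fix x y assume "x \<in> carrier Q" "y \<in> carrier Q"
    then show "x \<oplus>\<^bsub>Q\<^esub> y = y \<oplus>\<^bsub>Q\<^esub> x" by (auto simp: Q add intro: arg_cong[OF M.M.a_comm])
  qed (auto simp: Q add M.M.a_assoc)
  then show ?thesis
    by (intro left_module.intro left_module_axioms.intro M.R.ring_axioms)
       (auto simp: Q add smult M.smult_l_distr M.smult_r_distr M.smult_assoc)
qed

text \<open>The factor module is realised on a system of representatives of the cosets, so that its
  elements have the same type as those of the module itself.\<close>

lemma quotient_module_exists:
  fixes M :: "('l, 'u) module"
  assumes "left_module L M" "submodule U L M"
  shows "\<exists>(Q :: ('l, 'u) module) p. left_module L Q \<and> p \<in> module_hom L M Q \<and>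
    p ` carrier M = carrier Q \<and> a_kernel M Q p = U"
proof -
  interpret M: left_module L M by fact
  note [simp] = M.submodule_iff
  have U: "U \<subseteq> carrier M" "\<zero>\<^bsub>M\<^esub> \<in> U" "\<And>x y. x \<in> U \<Longrightarrow> y \<in> U \<Longrightarrow> x \<oplus>\<^bsub>M\<^esub> y \<in> U"
    "\<And>a x. a \<in> carrier L \<Longrightarrow> x \<in> U \<Longrightarrow> a \<odot>\<^bsub>M\<^esub> x \<in> U"
    using assms(2) by auto
  \<comment> \<open>\<open>p x\<close> is a fixed representative of the coset of \<open>x\<close>.\<close>
  define p where "p x = (SOME y. y \<in> carrier M \<and> (\<exists>u\<in>U. y = x \<oplus>\<^bsub>M\<^esub> u))" for x
  have p_ex: "p x \<in> carrier M \<and> (\<exists>u\<in>U. p x = x \<oplus>\<^bsub>M\<^esub> u)" if "x \<in> carrier M" for x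
    unfolding p_def by (rule someI[of _ x]) (use that U in \<open>auto intro!: bexI[of _ "\<zero>\<^bsub>M\<^esub>"]\<close>)
  have p_eq: "p (x \<oplus>\<^bsub>M\<^esub> u) = p x" if "x \<in> carrier M" "u \<in> U" for x u
  proof -
    have uM: "v \<in> carrier M" if "v \<in> U" for v using that U by auto
    have "(\<exists>v\<in>U. y = x \<oplus>\<^bsub>M\<^esub> u \<oplus>\<^bsub>M\<^esub> v) \<longleftrightarrow> (\<exists>v\<in>U. y = x \<oplus>\<^bsub>M\<^esub> v)" for y
    proof safe
      fix v assume "v \<in> U"
      then show "\<exists>w\<in>U. x \<oplus>\<^bsub>M\<^esub> u \<oplus>\<^bsub>M\<^esub> v = x \<oplus>\<^bsub>M\<^esub> w"
        using that U uM by (intro bexI[of _ "u \<oplus>\<^bsub>M\<^esub> v"]) (auto simp: M.M.a_assoc)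
    next
      fix v assume v: "v \<in> U"
      then have "v \<ominus>\<^bsub>M\<^esub> u \<in> U" using that assms(2) M.submodule_minus by blast
      moreover have "x \<oplus>\<^bsub>M\<^esub> v = x \<oplus>\<^bsub>M\<^esub> u \<oplus>\<^bsub>M\<^esub> (v \<ominus>\<^bsub>M\<^esub> u)"
      proof -
        have "x \<oplus>\<^bsub>M\<^esub> u \<oplus>\<^bsub>M\<^esub> (v \<ominus>\<^bsub>M\<^esub> u) = x \<oplus>\<^bsub>M\<^esub> v \<oplus>\<^bsub>M\<^esub> (u \<oplus>\<^bsub>M\<^esub> \<ominus>\<^bsub>M\<^esub> u)"
          using that v uM[of u] uM[of v] by (simp add: M.M.minus_eq M.M.a_ac)
        then show ?thesis
          using that v uM[of u] uM[of v] by (simp add: M.M.r_neg)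
      qed
      ultimately show "\<exists>w\<in>U. x \<oplus>\<^bsub>M\<^esub> v = x \<oplus>\<^bsub>M\<^esub> u \<oplus>\<^bsub>M\<^esub> w" by blast
    qed
    then show ?thesis by (simp add: p_def)
  qed
  define Q :: "('l, 'u) module" where "Q =
    \<lparr>carrier = p ` carrier M, mult = undefined, one = undefined, zero = p \<zero>\<^bsub>M\<^esub>,
     add = (\<lambda>a b. p (a \<oplus>\<^bsub>M\<^esub> b)), smult = (\<lambda>r a. p (r \<odot>\<^bsub>M\<^esub> a))\<rparr>"
  have add: "p x \<oplus>\<^bsub>Q\<^esub> p y = p (x \<oplus>\<^bsub>M\<^esub> y)" if xy: "x \<in> carrier M" "y \<in> carrier M" for x y
  proof -
    obtain u v where uv: "u \<in> U" "v \<in> U" "p x = x \<oplus>\<^bsub>M\<^esub> u" "p y = y \<oplus>\<^bsub>M\<^esub> v"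
      using p_ex xy by blast
    then have "u \<in> carrier M" "v \<in> carrier M" using U by auto
    then have "p x \<oplus>\<^bsub>M\<^esub> p y = (x \<oplus>\<^bsub>M\<^esub> y) \<oplus>\<^bsub>M\<^esub> (u \<oplus>\<^bsub>M\<^esub> v)"
      using xy uv by (simp add: M.M.a_ac)
    then show ?thesis using p_eq[of "x \<oplus>\<^bsub>M\<^esub> y" "u \<oplus>\<^bsub>M\<^esub> v"] xy uv U by (simp add: Q_def)
  qed
  have smult: "a \<odot>\<^bsub>Q\<^esub> p x = p (a \<odot>\<^bsub>M\<^esub> x)" if ax: "a \<in> carrier L" "x \<in> carrier M" for a x
  proof -
    obtain u where u: "u \<in> U" "p x = x \<oplus>\<^bsub>M\<^esub> u" using p_ex ax by blast
    then have "a \<odot>\<^bsub>M\<^esub> p x = a \<odot>\<^bsub>M\<^esub> x \<oplus>\<^bsub>M\<^esub> a \<odot>\<^bsub>M\<^esub> u"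
      using ax U by (auto simp: M.smult_r_distr)
    then show ?thesis using p_eq[of "a \<odot>\<^bsub>M\<^esub> x" "a \<odot>\<^bsub>M\<^esub> u"] ax u U by (simp add: Q_def)
  qed
  have "left_module L Q"
    by (rule left_module_image[OF assms(1), where p = p]) (simp_all add: add smult, simp_all add: Q_def)
  moreover have "p \<in> module_hom L M Q"
    by (auto simp: module_hom_def add smult) (simp add: Q_def)
  moreover have "a_kernel M Q p = U"
  proof
    have z: "\<zero>\<^bsub>Q\<^esub> = p \<zero>\<^bsub>M\<^esub>" by (simp add: Q_def)
    show "U \<subseteq> a_kernel M Q p"
    proof
      fix u assume u: "u \<in> U"
      then have "u \<in> carrier M" using U by blast
      moreover from this have "p u = p \<zero>\<^bsub>M\<^esub>" using p_eq[of "\<zero>\<^bsub>M\<^esub>" u] u by simp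
      ultimately show "u \<in> a_kernel M Q p" by (simp add: a_kernel_def' z)
    qed
    show "a_kernel M Q p \<subseteq> U"
    proof
      fix x assume "x \<in> a_kernel M Q p"
      then have x: "x \<in> carrier M" "p x = p \<zero>\<^bsub>M\<^esub>" by (auto simp: a_kernel_def' z)
      obtain u v where uv: "u \<in> U" "v \<in> U" "p x = x \<oplus>\<^bsub>M\<^esub> u" "p x = \<zero>\<^bsub>M\<^esub> \<oplus>\<^bsub>M\<^esub> v"
        using p_ex[of x] p_ex[of "\<zero>\<^bsub>M\<^esub>"] x by auto
      then have "u \<in> carrier M" "v \<in> carrier M" using U by auto
      then have "x = v \<ominus>\<^bsub>M\<^esub> u"
        using uv x(1) M.M.add.inv_solve_right[of x v u] by (simp add: M.M.minus_eq)
      then show "x \<in> U" using M.submodule_minus[OF assms(2) uv(2,1)] by simp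
    qed
  qed
  moreover have "p ` carrier M = carrier Q" by (simp add: Q_def)
  ultimately show ?thesis by blast
qed

section \<open>Generators and finite length\<close>

text \<open>The submodule generated by \<open>S\<close>, as the least submodule that contains \<open>S\<close>. This form spares
  the linear combinations in which \<^const>\<open>finitely_generated\<close> is phrased; the two notions are
  compared in \<open>finitely_generated_iff_span\<close>.\<close>

definition submodule_span ::
  "('l, 'c) ring_scheme \<Rightarrow> ('l, 'u, 'd) module_scheme \<Rightarrow> 'u set \<Rightarrow> 'u set"
  where "submodule_span L M S = \<Inter>{K. submodule K L M \<and> S \<subseteq> K}"

context left_module
begin

lemma span_superset: "S \<subseteq> submodule_span L M S"
  by (auto simp: submodule_span_def)

lemma span_minimal: "submodule K L M \<Longrightarrow> S \<subseteq> K \<Longrightarrow> submodule_span L M S \<subseteq> K"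
  by (auto simp: submodule_span_def)

lemma submodule_submodule_span:
  assumes "S \<subseteq> carrier M"
  shows "submodule (submodule_span L M S) L M"
proof -
  have "submodule_span L M S \<subseteq> carrier M" by (rule span_minimal[OF submodule_carrier assms])
  then show ?thesis unfolding submodule_iff by (auto simp: submodule_span_def submodule_iff)
qed

lemma submodule_plus_cyclic:
  assumes "submodule K L M" "e \<in> carrier M"
  shows "submodule {k \<oplus>\<^bsub>M\<^esub> a \<odot>\<^bsub>M\<^esub> e |k a. k \<in> K \<and> a \<in> carrier L} L M" (is "submodule ?P L M")
proof -
  have K: "K \<subseteq> carrier M" "\<zero>\<^bsub>M\<^esub> \<in> K" "\<And>x y. x \<in> K \<Longrightarrow> y \<in> K \<Longrightarrow> x \<oplus>\<^bsub>M\<^esub> y \<in> K"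
    "\<And>a x. a \<in> carrier L \<Longrightarrow> x \<in> K \<Longrightarrow> a \<odot>\<^bsub>M\<^esub> x \<in> K"
    using assms(1) by (auto simp: submodule_iff)
  have "\<zero>\<^bsub>M\<^esub> = \<zero>\<^bsub>M\<^esub> \<oplus>\<^bsub>M\<^esub> \<zero>\<^bsub>L\<^esub> \<odot>\<^bsub>M\<^esub> e" using assms(2) by (simp add: smult_l_null)
  then have "\<zero>\<^bsub>M\<^esub> \<in> ?P" using K(2) by blast
  moreover have "x \<oplus>\<^bsub>M\<^esub> y \<in> ?P" if "x \<in> ?P" "y \<in> ?P" for x y
  proof -
    from that obtain k a l b where *: "k \<in> K" "a \<in> carrier L" "l \<in> K" "b \<in> carrier L"
      "x = k \<oplus>\<^bsub>M\<^esub> a \<odot>\<^bsub>M\<^esub> e" "y = l \<oplus>\<^bsub>M\<^esub> b \<odot>\<^bsub>M\<^esub> e" by blast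
    then have "k \<in> carrier M" "l \<in> carrier M" using K by auto
    then have "x \<oplus>\<^bsub>M\<^esub> y = (k \<oplus>\<^bsub>M\<^esub> l) \<oplus>\<^bsub>M\<^esub> (a \<oplus>\<^bsub>L\<^esub> b) \<odot>\<^bsub>M\<^esub> e"
      using * assms(2) by (simp add: smult_l_distr M.a_ac)
    moreover have "k \<oplus>\<^bsub>M\<^esub> l \<in> K" "a \<oplus>\<^bsub>L\<^esub> b \<in> carrier L" using * K(3) by auto
    ultimately show ?thesis by blast
  qed
  moreover have "b \<odot>\<^bsub>M\<^esub> x \<in> ?P" if "b \<in> carrier L" "x \<in> ?P" for b x
  proof -
    from that obtain k a where *: "k \<in> K" "a \<in> carrier L" "x = k \<oplus>\<^bsub>M\<^esub> a \<odot>\<^bsub>M\<^esub> e" by blast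
    then have "k \<in> carrier M" using K by auto
    then have "b \<odot>\<^bsub>M\<^esub> x = (b \<odot>\<^bsub>M\<^esub> k) \<oplus>\<^bsub>M\<^esub> (b \<otimes>\<^bsub>L\<^esub> a) \<odot>\<^bsub>M\<^esub> e"
      using * assms(2) that by (simp add: smult_r_distr smult_assoc)
    moreover have "b \<odot>\<^bsub>M\<^esub> k \<in> K" "b \<otimes>\<^bsub>L\<^esub> a \<in> carrier L" using * K(4) that(1) by auto
    ultimately show ?thesis by blast
  qed
  moreover have "?P \<subseteq> carrier M" using K(1) assms(2) by auto
  ultimately show ?thesis unfolding submodule_iff by (intro conjI ballI) assumption+
qed

lemma span_insert:
  assumes "S \<subseteq> carrier M" "e \<in> carrier M"
  shows "submodule_span L M (insert e S) =
    {k \<oplus>\<^bsub>M\<^esub> a \<odot>\<^bsub>M\<^esub> e |k a. k \<in> submodule_span L M S \<and> a \<in> carrier L}" (is "_ = ?P")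
proof
  note K = submodule_submodule_span[OF assms(1)]
  have Kc: "submodule_span L M S \<subseteq> carrier M" using K by (simp add: submodule_iff)
  show "submodule_span L M (insert e S) \<subseteq> ?P"
  proof (rule span_minimal[OF submodule_plus_cyclic[OF K assms(2)]], rule insert_subsetI)
    have "e = \<zero>\<^bsub>M\<^esub> \<oplus>\<^bsub>M\<^esub> \<one>\<^bsub>L\<^esub> \<odot>\<^bsub>M\<^esub> e" using assms(2) by simp
    then show "e \<in> ?P" using K by (auto simp: submodule_iff)
    show "S \<subseteq> ?P"
    proof
      fix s assume s: "s \<in> S"
      then have "s = s \<oplus>\<^bsub>M\<^esub> \<zero>\<^bsub>L\<^esub> \<odot>\<^bsub>M\<^esub> e" using assms by (auto simp: smult_l_null)
      then show "s \<in> ?P" using s span_superset by blast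
    qed
  qed
  have ins: "insert e S \<subseteq> carrier M" using assms by auto
  have "submodule_span L M S \<subseteq> submodule_span L M (insert e S)"
    by (auto simp: submodule_span_def)
  moreover have "e \<in> submodule_span L M (insert e S)" using span_superset by blast
  ultimately show "?P \<subseteq> submodule_span L M (insert e S)"
    using submodule_submodule_span[OF ins] by (auto simp: submodule_iff)
qed

lemma span_empty: "submodule_span L M {} = {\<zero>\<^bsub>M\<^esub>}"
  using span_minimal[OF submodule_zero, of "{}"] submodule_submodule_span[of "{}"]
  by (auto simp: submodule_iff)

lemma finitely_generated_iff_span:
  "finitely_generated L M \<longleftrightarrow> (\<exists>S. finite S \<and> S \<subseteq> carrier M \<and> submodule_span L M S = carrier M)"
proof
  assume "finitely_generated L M"
  then obtain S where S: "finite S" "S \<subseteq> carrier M"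
    and gen: "\<And>x. x \<in> carrier M \<Longrightarrow> \<exists>c\<in>S \<rightarrow> carrier L. x = (\<Oplus>\<^bsub>M\<^esub>s\<in>S. c s \<odot>\<^bsub>M\<^esub> s)"
    unfolding finitely_generated_def by blast
  note K = submodule_submodule_span[OF S(2)]
  have "x \<in> submodule_span L M S" if "x \<in> carrier M" for x
  proof -
    obtain c where c: "c \<in> S \<rightarrow> carrier L" "x = (\<Oplus>\<^bsub>M\<^esub>s\<in>S. c s \<odot>\<^bsub>M\<^esub> s)"
      using gen[OF \<open>x \<in> carrier M\<close>] by blast
    have "(\<lambda>s. c s \<odot>\<^bsub>M\<^esub> s) \<in> S \<rightarrow> submodule_span L M S"
      using c(1) K span_superset[of S] by (auto simp: submodule_iff Pi_iff subset_iff)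
    then show ?thesis unfolding c(2) by (rule submodule_finsum[OF K S(1)])
  qed
  then show "\<exists>S. finite S \<and> S \<subseteq> carrier M \<and> submodule_span L M S = carrier M"
    using S K by (intro exI[of _ S]) (auto simp: submodule_iff)
next
  assume "\<exists>S. finite S \<and> S \<subseteq> carrier M \<and> submodule_span L M S = carrier M"
  then obtain S where S: "finite S" "S \<subseteq> carrier M" "submodule_span L M S = carrier M" by blast
  have "\<forall>x\<in>submodule_span L M S. \<exists>c\<in>S \<rightarrow> carrier L. x = (\<Oplus>\<^bsub>M\<^esub>s\<in>S. c s \<odot>\<^bsub>M\<^esub> s)"
    using S(1,2)
  proof (induction S)
    case empty
    then show ?case by (simp add: span_empty)
  next
    case (insert e S)
    show ?case
    proof
      fix x assume "x \<in> submodule_span L M (insert e S)"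
      then obtain k a where ka: "k \<in> submodule_span L M S" "a \<in> carrier L"
        "x = k \<oplus>\<^bsub>M\<^esub> a \<odot>\<^bsub>M\<^esub> e"
        using span_insert[of S e] insert.prems by auto
      then obtain c where c: "c \<in> S \<rightarrow> carrier L" "k = (\<Oplus>\<^bsub>M\<^esub>s\<in>S. c s \<odot>\<^bsub>M\<^esub> s)"
        using insert by auto
      let ?c = "c(e := a)"
      have S: "(\<lambda>s. c s \<odot>\<^bsub>M\<^esub> s) \<in> S \<rightarrow> carrier M" using c insert.prems by auto
      have "(\<Oplus>\<^bsub>M\<^esub>s\<in>S. ?c s \<odot>\<^bsub>M\<^esub> s) = k"
        unfolding c(2) by (rule M.finsum_cong') (use S insert.hyps in auto)
      then have "(\<Oplus>\<^bsub>M\<^esub>s\<in>insert e S. ?c s \<odot>\<^bsub>M\<^esub> s) = a \<odot>\<^bsub>M\<^esub> e \<oplus>\<^bsub>M\<^esub> k"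
        using insert.hyps insert.prems ka(2) c(1) by (subst M.finsum_insert) (auto simp: Pi_iff)
      also have "\<dots> = x"
        using M.finsum_closed[OF S] insert.prems ka(2) unfolding ka(3) c(2)
        by (intro M.a_comm) auto
      finally show "\<exists>c\<in>insert e S \<rightarrow> carrier L. x = (\<Oplus>\<^bsub>M\<^esub>s\<in>insert e S. c s \<odot>\<^bsub>M\<^esub> s)"
        using ka(2) c(1) by (intro bexI[of _ ?c]) auto
    qed
  qed
  then show "finitely_generated L M"
    unfolding finitely_generated_def using S by auto
qed

end

text \<open>A strictly monotone map from the submodules to the natural numbers. It need not be the
  length, and no additivity is asked for; its existence alone characterises finite length.\<close>

definition rank_function ::
  "('l, 'c) ring_scheme \<Rightarrow> ('l, 'u, 'd) module_scheme \<Rightarrow> ('u set \<Rightarrow> nat) \<Rightarrow> bool"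
  where "rank_function L M \<rho> \<longleftrightarrow>
    (\<forall>A B. submodule A L M \<longrightarrow> submodule B L M \<longrightarrow> A \<subset> B \<longrightarrow> \<rho> A < \<rho> B)"

context left_module
begin

text \<open>A rank function of \<open>A\<close> extends over a simple factor \<open>B/A\<close>: a submodule \<open>D\<close> of \<open>B\<close> gets the
  rank of \<open>D \<inter> A\<close>, increased by one if \<open>D\<close> is not contained in \<open>A\<close>. Strict monotonicity is the
  modular law: if \<open>D \<subset> E\<close> meet \<open>A\<close> in the same submodule and \<open>D + A = B\<close>, then \<open>D = E\<close>.\<close>

lemma rank_function_step:
  assumes A: "submodule A L M" and B: "submodule B L M" and "A \<subseteq> B"
    and simple: "\<not> (\<exists>K. submodule K L M \<and> A \<subset> K \<and> K \<subset> B)"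
    and \<rho>: "rank_function L (M\<lparr>carrier := A\<rparr>) \<rho>"
  shows "\<exists>\<rho>'. rank_function L (M\<lparr>carrier := B\<rparr>) \<rho>'"
proof -
  define \<rho>' where "\<rho>' D = \<rho> (D \<inter> A) + (if D \<subseteq> A then 0 else 1)" for D
  have "\<rho>' D < \<rho>' E"
    if D: "submodule D L M" and E: "submodule E L M" "E \<subseteq> B" and DE: "D \<subset> E" for D E
  proof (cases "D \<inter> A = E \<inter> A")
    case False
    then have "D \<inter> A \<subset> E \<inter> A" using DE by blast
    then have "\<rho> (D \<inter> A) < \<rho> (E \<inter> A)"
      using \<rho> D E A by (auto simp: rank_function_def submodule_trans_iff submodule_Int)
    then show ?thesis using DE by (auto simp: \<rho>'_def)
  next
    case True
    have "D \<subseteq> A"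
    proof (rule ccontr)
      assume nD: "\<not> D \<subseteq> A"
      define P where "P = {x \<in> carrier M. \<exists>d\<in>D. \<exists>a\<in>A. x = d \<oplus>\<^bsub>M\<^esub> a}"
      have D': "D \<subseteq> carrier M" "\<zero>\<^bsub>M\<^esub> \<in> D" and A': "A \<subseteq> carrier M" "\<zero>\<^bsub>M\<^esub> \<in> A"
        using A D by (auto simp: submodule_iff)
      have P: "submodule P L M" unfolding submodule_iff
      proof (intro conjI ballI)
        show "P \<subseteq> carrier M" by (auto simp: P_def)
        show "\<zero>\<^bsub>M\<^esub> \<in> P" using D' A' by (auto simp: P_def intro!: bexI[of _ "\<zero>\<^bsub>M\<^esub>"])
        fix x y assume "x \<in> P" "y \<in> P"
        then obtain d a d' a' where *: "d \<in> D" "a \<in> A" "d' \<in> D" "a' \<in> A"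
          "x = d \<oplus>\<^bsub>M\<^esub> a" "y = d' \<oplus>\<^bsub>M\<^esub> a'" by (auto simp: P_def)
        then have c: "d \<in> carrier M" "a \<in> carrier M" "d' \<in> carrier M" "a' \<in> carrier M"
          using D' A' by auto
        have "x \<oplus>\<^bsub>M\<^esub> y = (d \<oplus>\<^bsub>M\<^esub> d') \<oplus>\<^bsub>M\<^esub> (a \<oplus>\<^bsub>M\<^esub> a')" using c * by (simp add: M.a_ac)
        moreover have "d \<oplus>\<^bsub>M\<^esub> d' \<in> D" "a \<oplus>\<^bsub>M\<^esub> a' \<in> A"
          using * A D by (auto simp: submodule_iff)
        ultimately show "x \<oplus>\<^bsub>M\<^esub> y \<in> P" unfolding P_def using c by auto
      next
        fix b x assume b: "b \<in> carrier L" and "x \<in> P"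
        then obtain d a where *: "d \<in> D" "a \<in> A" "x = d \<oplus>\<^bsub>M\<^esub> a" by (auto simp: P_def)
        then have c: "d \<in> carrier M" "a \<in> carrier M" using D' A' by auto
        have "b \<odot>\<^bsub>M\<^esub> x = b \<odot>\<^bsub>M\<^esub> d \<oplus>\<^bsub>M\<^esub> b \<odot>\<^bsub>M\<^esub> a" using b c * by (simp add: smult_r_distr)
        moreover have "b \<odot>\<^bsub>M\<^esub> d \<in> D" "b \<odot>\<^bsub>M\<^esub> a \<in> A"
          using b * A D by (auto simp: submodule_iff)
        ultimately show "b \<odot>\<^bsub>M\<^esub> x \<in> P" unfolding P_def using b c by auto
      qed
      have "A \<subseteq> P"
      proof
        fix a assume a: "a \<in> A"
        then have "a \<in> carrier M" "a = \<zero>\<^bsub>M\<^esub> \<oplus>\<^bsub>M\<^esub> a" using A' by auto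
        then show "a \<in> P" using a D' unfolding P_def by blast
      qed
      have DP: "D \<subseteq> P"
      proof
        fix d assume d: "d \<in> D"
        then have "d \<in> carrier M" "d = d \<oplus>\<^bsub>M\<^esub> \<zero>\<^bsub>M\<^esub>" using D' by auto
        then show "d \<in> P" using d A' unfolding P_def by blast
      qed
      have "P \<subseteq> B"
      proof
        fix x assume "x \<in> P"
        then obtain d a where "d \<in> D" "a \<in> A" "x = d \<oplus>\<^bsub>M\<^esub> a" by (auto simp: P_def)
        moreover from this have "d \<in> B" "a \<in> B" using E(2) DE \<open>A \<subseteq> B\<close> by auto
        ultimately show "x \<in> B" using B by (auto simp: submodule_iff)
      qed
      with \<open>A \<subseteq> P\<close> have "P = B" using simple P nD DP by blast
      have "E \<subseteq> D"
      proof
        fix x assume x: "x \<in> E"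
        then obtain d a where da: "d \<in> D" "a \<in> A" "x = d \<oplus>\<^bsub>M\<^esub> a"
          using \<open>P = B\<close> E(2) by (auto simp: P_def)
        then have c: "d \<in> carrier M" "a \<in> carrier M" using D' A' by auto
        have "x \<ominus>\<^bsub>M\<^esub> d \<in> E" using x da DE submodule_minus[OF E(1)] by blast
        moreover have "x \<ominus>\<^bsub>M\<^esub> d = a" using da c by (simp add: M.minus_eq M.a_ac M.r_neg M.r_neg1)
        ultimately have "a \<in> D" using True da by blast
        then show "x \<in> D" using da D by (auto simp: submodule_iff)
      qed
      with DE show False by blast
    qed
    then show ?thesis using True DE by (auto simp: \<rho>'_def)
  qed
  then have "rank_function L (M\<lparr>carrier := B\<rparr>) \<rho>'"
    by (auto simp: rank_function_def submodule_trans_iff B)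
  then show ?thesis by blast
qed

lemma rank_function_zero: "rank_function L (M\<lparr>carrier := {\<zero>\<^bsub>M\<^esub>}\<rparr>) \<rho>"
proof -
  have "K = {\<zero>\<^bsub>M\<^esub>}" if "submodule K L (M\<lparr>carrier := {\<zero>\<^bsub>M\<^esub>}\<rparr>)" for K
    using that unfolding submodule_trans_iff[OF submodule_zero] submodule_iff by blast
  then show ?thesis unfolding rank_function_def by blast
qed

lemma rank_function_carrier:
  "rank_function L (M\<lparr>carrier := carrier M\<rparr>) \<rho> \<longleftrightarrow> rank_function L M \<rho>"
proof -
  have "submodule K L (M\<lparr>carrier := carrier M\<rparr>) \<longleftrightarrow> submodule K L M" for K
    unfolding submodule_trans_iff[OF submodule_carrier] submodule_iff by blast
  then show ?thesis by (simp add: rank_function_def)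
qed

text \<open>A composition series from \<open>A\<close> upwards is obtained by passing each time to a strictly larger
  submodule of least rank.\<close>

lemma composition_series_exists:
  assumes "rank_function L M \<rho>" "submodule A L M"
  shows "\<exists>n (N :: nat \<Rightarrow> 'u set). N 0 = A \<and> N n = carrier M \<and> (\<forall>i\<le>n. submodule (N i) L M) \<and>
      (\<forall>i<n. N i \<subset> N (Suc i) \<and>
        \<not> (\<exists>K. submodule K L M \<and> N i \<subset> K \<and> K \<subset> N (Suc i)))"
  using assms(2)
proof (induction "\<rho> (carrier M) - \<rho> A" arbitrary: A rule: less_induct)
  case less
  note \<rho> = assms(1)[unfolded rank_function_def, rule_format]
  show ?case
  proof (cases "A = carrier M")
    case True
    then show ?thesis using less.prems by (intro exI[of _ 0] exI[of _ "\<lambda>_. A"]) auto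
  next
    case False
    then have lt: "A \<subset> carrier M" using less.prems by (auto simp: submodule_iff)
    define B where "B = arg_min \<rho> (\<lambda>B. submodule B L M \<and> A \<subset> B)"
    have ex: "submodule (carrier M) L M \<and> A \<subset> carrier M" using lt submodule_carrier by blast
    have B: "submodule B L M" "A \<subset> B"
      using arg_min_natI[of "\<lambda>B. submodule B L M \<and> A \<subset> B" "carrier M" \<rho>] ex
      by (auto simp: B_def)
    have min: "\<rho> B \<le> \<rho> K" if "submodule K L M" "A \<subset> K" for K
      using arg_min_nat_le[of "\<lambda>B. submodule B L M \<and> A \<subset> B" K \<rho>] that by (auto simp: B_def)
    have simple: "\<not> (\<exists>K. submodule K L M \<and> A \<subset> K \<and> K \<subset> B)"
      using min \<rho> B(1) by (metis leD)
    have "\<rho> A < \<rho> B" "\<rho> A < \<rho> (carrier M)" using \<rho> B less.prems ex by blast+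
    then obtain n N where N: "N 0 = B" "N n = carrier M" "\<forall>i\<le>n. submodule (N i) L M"
      "\<forall>i<n. N i \<subset> N (Suc i) \<and> \<not> (\<exists>K. submodule K L M \<and> N i \<subset> K \<and> K \<subset> N (Suc i))"
      using less.hyps[of B] B(1) by (metis diff_less_mono2)
    show ?thesis
      using N B simple less.prems
      by (intro exI[of _ "Suc n"] exI[of _ "case_nat A N"]) (auto split: nat.split simp: less_Suc_eq_0_disj)
  qed
qed

lemma finite_length_iff_rank: "finite_length L M \<longleftrightarrow> (\<exists>\<rho>. rank_function L M \<rho>)"
proof
  assume "\<exists>\<rho>. rank_function L M \<rho>"
  then show "finite_length L M"
    unfolding finite_length_def using composition_series_exists submodule_zero by blast
next
  assume "finite_length L M"
  then obtain n and N :: "nat \<Rightarrow> 'u set" where N: "N 0 = {\<zero>\<^bsub>M\<^esub>}" "N n = carrier M"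
    and sub: "\<And>i. i \<le> n \<Longrightarrow> submodule (N i) L M"
    and simple: "\<And>i. i < n \<Longrightarrow> N i \<subset> N (Suc i) \<and>
        \<not> (\<exists>K. submodule K L M \<and> N i \<subset> K \<and> K \<subset> N (Suc i))"
    unfolding finite_length_def by blast
  have "\<exists>\<rho>. rank_function L (M\<lparr>carrier := N i\<rparr>) \<rho>" if "i \<le> n" for i
    using that
  proof (induction i)
    case 0
    then show ?case using rank_function_zero by (auto simp: N)
  next
    case (Suc i)
    then obtain \<rho> where \<rho>: "rank_function L (M\<lparr>carrier := N i\<rparr>) \<rho>" by auto
    have "N i \<subseteq> N (Suc i)" using simple[of i] Suc.prems by auto
    then show ?case
      using Suc.prems by (intro rank_function_step[OF sub sub _ _ \<rho>] conjunct2[OF simple]) simp_all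
  qed
  from this[of n] show "\<exists>\<rho>. rank_function L M \<rho>" by (simp add: N rank_function_carrier)
qed

lemma finite_length_submodule:
  assumes "finite_length L M" "submodule H L M"
  shows "finite_length L (M\<lparr>carrier := H\<rparr>)"
proof -
  interpret H: left_module L "M\<lparr>carrier := H\<rparr>" by (rule submodule_left_module[OF assms(2)])
  obtain \<rho> where "rank_function L M \<rho>" using assms(1) by (auto simp: finite_length_iff_rank)
  then have "rank_function L (M\<lparr>carrier := H\<rparr>) \<rho>"
    by (auto simp: rank_function_def submodule_trans_iff[OF assms(2)])
  then show ?thesis by (auto simp: H.finite_length_iff_rank)
qed

text \<open>A finite set whose span has the greatest possible rank generates the module.\<close>

lemma finite_length_imp_finitely_generated:
  assumes "finite_length L M"
  shows "finitely_generated L M"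
proof -
  obtain \<rho> where \<rho>: "rank_function L M \<rho>" using assms by (auto simp: finite_length_iff_rank)
  let ?r = "\<lambda>S. \<rho> (submodule_span L M S)"
  have le: "?r S \<le> \<rho> (carrier M)" if "S \<subseteq> carrier M" for S
  proof (cases "submodule_span L M S = carrier M")
    case False
    then have "submodule_span L M S \<subset> carrier M"
      using submodule_submodule_span[OF that] by (auto simp: submodule_iff)
    then have "?r S < \<rho> (carrier M)"
      using \<rho> submodule_submodule_span[OF that] submodule_carrier by (simp add: rank_function_def)
    then show ?thesis by simp
  qed simp
  let ?P = "\<lambda>S. finite S \<and> S \<subseteq> carrier M"
  have "\<exists>S. ?P S \<and> (\<forall>T. ?P T \<longrightarrow> ?r T \<le> ?r S)"
  proof (rule ex_has_greatest_nat)
    show "?P {}" by simp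
    show "\<forall>T. ?P T \<longrightarrow> ?r T < Suc (\<rho> (carrier M))" using le by (simp add: less_Suc_eq_le)
  qed
  then obtain S where max: "?P S \<and> (\<forall>T. ?P T \<longrightarrow> ?r T \<le> ?r S)" by (rule exE)
  then have S: "finite S" "S \<subseteq> carrier M" by simp_all
  have "x \<in> submodule_span L M S" if "x \<in> carrier M" for x
  proof (rule ccontr)
    assume x: "x \<notin> submodule_span L M S"
    have T: "insert x S \<subseteq> carrier M" using S that by simp
    have "submodule_span L M S \<subset> submodule_span L M (insert x S)"
    proof
      show "submodule_span L M S \<subseteq> submodule_span L M (insert x S)"
        by (auto simp: submodule_span_def)
      show "submodule_span L M S \<noteq> submodule_span L M (insert x S)"
        using x span_superset[of "insert x S"] by auto
    qed
    then have "?r S < ?r (insert x S)"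
      using \<rho> submodule_submodule_span[OF T] submodule_submodule_span[OF S(2)]
      by (auto simp: rank_function_def)
    moreover have "?r (insert x S) \<le> ?r S" using max S(1) T by blast
    ultimately show False by simp
  qed
  then show ?thesis
    using S submodule_submodule_span[OF S(2)]
    by (auto simp: finitely_generated_iff_span submodule_iff intro!: exI[of _ S])
qed

end

lemma finite_length_image:
  assumes "left_module L M" "left_module L Q" "p \<in> module_hom L M Q" "p ` carrier M = carrier Q"
    and "finite_length L M"
  shows "finite_length L Q"
proof -
  interpret M: left_module L M by fact
  interpret Q: left_module L Q by fact
  obtain \<rho> where \<rho>: "rank_function L M \<rho>" using assms(5) by (auto simp: M.finite_length_iff_rank)
  let ?v = "\<lambda>K. {x \<in> carrier M. p x \<in> K}"
  have "\<rho> (?v A) < \<rho> (?v B)" if AB: "submodule A L Q" "submodule B L Q" "A \<subset> B" for A B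
  proof -
    obtain b where b: "b \<in> B" "b \<notin> A" using AB(3) by blast
    then have "b \<in> p ` carrier M" using AB(2) assms(4) by (auto simp: Q.submodule_iff)
    then have "?v A \<subset> ?v B" using b AB(3) by blast
    then show ?thesis
      using \<rho> submodule_vimage[OF assms(1-3)] AB by (simp add: rank_function_def)
  qed
  then have "rank_function L Q (\<lambda>K. \<rho> (?v K))" by (simp add: rank_function_def)
  then show ?thesis by (auto simp: Q.finite_length_iff_rank)
qed

section \<open>Module-finite algebras over a local ring\<close>

lemma (in ring) proper_ideal_le_maximalideal:
  assumes "ideal I R" "I \<noteq> carrier R"
  shows "\<exists>J. maximalideal J R \<and> I \<subseteq> J"
proof -
  let ?A = "{J. ideal J R \<and> I \<subseteq> J \<and> \<one> \<notin> J}"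
  have one: "J = carrier R" if "ideal J R" "\<one> \<in> J" for J
    using ideal.one_imp_carrier[OF that] .
  have "\<exists>J\<in>?A. \<forall>K\<in>?A. J \<subseteq> K \<longrightarrow> K = J"
  proof (rule subset_Zorn_nonempty)
    show "?A \<noteq> {}" using assms one by blast
    fix C assume C: "C \<noteq> {}" "subset.chain ?A C"
    then have "subset.chain {J. ideal J R} C" by (auto simp: pred_on.chain_def)
    then have "ideal (\<Union>C) R" using chain_Union_is_ideal[of C] C(1) by auto
    then show "\<Union>C \<in> ?A" using C by (auto simp: pred_on.chain_def)
  qed
  then obtain J where "J \<in> ?A" and max: "\<forall>K\<in>?A. J \<subseteq> K \<longrightarrow> K = J" by (rule bexE)
  then have J: "ideal J R" "I \<subseteq> J" "\<one> \<notin> J" by auto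
  have "maximalideal J R"
  proof (rule maximalidealI[OF J(1)])
    show "carrier R \<noteq> J" using J(3) by auto
    show "K = J \<or> K = carrier R" if K: "ideal K R" "J \<subseteq> K" for K
    proof (cases "\<one> \<in> K")
      case True
      then show ?thesis using one[OF K(1)] by simp
    next
      case False
      then have "K \<in> ?A" using K J(2) by auto
      then show ?thesis using max K(2) by blast
    qed
  qed
  then show ?thesis using J(2) by blast
qed

lemma local_ring_Units:
  assumes "local_ring R m" "a \<in> carrier R" "a \<notin> m"
  shows "\<exists>b\<in>carrier R. b \<otimes>\<^bsub>R\<^esub> a = \<one>\<^bsub>R\<^esub>"
proof (rule ccontr)
  assume no: "\<not> ?thesis"
  interpret R: cring R using assms(1) by (simp add: local_ring_def)
  have "\<one>\<^bsub>R\<^esub> \<notin> PIdl\<^bsub>R\<^esub> a" using no by (auto simp: cgenideal_def)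
  then have "PIdl\<^bsub>R\<^esub> a \<noteq> carrier R" by auto
  then obtain J where "maximalideal J R" "PIdl\<^bsub>R\<^esub> a \<subseteq> J"
    using R.proper_ideal_le_maximalideal[OF R.cgenideal_ideal[OF assms(2)]] by blast
  then show False
    using assms R.cgenideal_self[OF assms(2)] by (auto simp: local_ring_def)
qed

text \<open>Nakayama's lemma for a single element \<open>t\<close> of the maximal ideal: a finitely generated module
  \<open>M\<close> with \<open>tM = M\<close> is zero. An element \<open>e\<close> of a generating set of least cardinality satisfies
  \<open>(1 - t r) e \<in> K\<close>, where \<open>K\<close> is the span of the other generators, and \<open>1 - t r\<close> is a unit.\<close>

lemma nakayama_local:
  assumes "local_ring R m" "left_module R M" "finitely_generated R M" "t \<in> m"
    and div: "\<And>x. x \<in> carrier M \<Longrightarrow> \<exists>y\<in>carrier M. x = t \<odot>\<^bsub>M\<^esub> y"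
  shows "carrier M = {\<zero>\<^bsub>M\<^esub>}"
proof -
  interpret R: cring R using assms(1) by (simp add: local_ring_def)
  interpret m: maximalideal m R using assms(1) by (simp add: local_ring_def)
  interpret M: left_module R M by fact
  let ?P = "\<lambda>G. finite G \<and> G \<subseteq> carrier M \<and> submodule_span R M G = carrier M"
  obtain G0 where "?P G0" using assms(3) by (auto simp: M.finitely_generated_iff_span)
  then have "\<exists>G. ?P G \<and> (\<forall>H. ?P H \<longrightarrow> card G \<le> card H)" by (rule ex_has_least_nat)
  then obtain G where GG: "?P G \<and> (\<forall>H. ?P H \<longrightarrow> card G \<le> card H)" by (rule exE)
  then have G: "?P G" and min: "\<And>H. ?P H \<Longrightarrow> card G \<le> card H" by simp_all
  show ?thesis
  proof (cases "G = {}")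
    case True
    then show ?thesis using G M.span_empty by simp
  next
    case False
    then obtain e where e: "e \<in> G" by blast
    define K where "K = submodule_span R M (G - {e})"
    have G': "G - {e} \<subseteq> carrier M" "e \<in> carrier M" using G e by auto
    have K: "submodule K R M" unfolding K_def by (rule M.submodule_submodule_span[OF G'(1)])
    have "t \<in> carrier R" using assms(4) m.a_subset by blast
    obtain y where y: "y \<in> carrier M" "e = t \<odot>\<^bsub>M\<^esub> y" using div[OF G'(2)] by blast
    have "insert e (G - {e}) = G" using e by blast
    then have "y \<in> submodule_span R M (insert e (G - {e}))" using y G by simp
    then obtain k r where kr: "k \<in> K" "r \<in> carrier R" "y = k \<oplus>\<^bsub>M\<^esub> r \<odot>\<^bsub>M\<^esub> e"
      unfolding M.span_insert[OF G'] K_def by blast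
    have k: "k \<in> carrier M" using kr(1) K by (auto simp: M.submodule_iff)
    define u where "u = \<one>\<^bsub>R\<^esub> \<ominus>\<^bsub>R\<^esub> t \<otimes>\<^bsub>R\<^esub> r"
    have u: "u \<in> carrier R" using \<open>t \<in> carrier R\<close> kr by (simp add: u_def)
    have tr: "t \<otimes>\<^bsub>R\<^esub> r \<in> m" using m.I_r_closed[OF assms(4) kr(2)] .
    have "u \<notin> m"
    proof
      assume "u \<in> m"
      then have "u \<oplus>\<^bsub>R\<^esub> t \<otimes>\<^bsub>R\<^esub> r \<in> m" using tr by (rule m.a_closed)
      then have "\<one>\<^bsub>R\<^esub> \<in> m"
        using \<open>t \<in> carrier R\<close> kr(2) by (simp add: u_def R.minus_eq R.a_ac R.r_neg R.l_neg)
      then show False using m.one_imp_carrier m.I_notcarr by blast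
    qed
    then obtain b where b: "b \<in> carrier R" "b \<otimes>\<^bsub>R\<^esub> u = \<one>\<^bsub>R\<^esub>"
      using local_ring_Units[OF assms(1) u] by blast
    have "u \<odot>\<^bsub>M\<^esub> e \<oplus>\<^bsub>M\<^esub> (t \<otimes>\<^bsub>R\<^esub> r) \<odot>\<^bsub>M\<^esub> e = (u \<oplus>\<^bsub>R\<^esub> t \<otimes>\<^bsub>R\<^esub> r) \<odot>\<^bsub>M\<^esub> e"
      using u \<open>t \<in> carrier R\<close> kr(2) G'(2) by (simp add: M.smult_l_distr)
    also have "u \<oplus>\<^bsub>R\<^esub> t \<otimes>\<^bsub>R\<^esub> r = \<one>\<^bsub>R\<^esub>"
      using \<open>t \<in> carrier R\<close> kr(2) by (simp add: u_def R.minus_eq R.a_ac R.r_neg R.l_neg)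
    also have "\<one>\<^bsub>R\<^esub> \<odot>\<^bsub>M\<^esub> e = t \<odot>\<^bsub>M\<^esub> k \<oplus>\<^bsub>M\<^esub> (t \<otimes>\<^bsub>R\<^esub> r) \<odot>\<^bsub>M\<^esub> e"
      using y(2) kr k \<open>t \<in> carrier R\<close> G'(2) by (simp add: M.smult_r_distr M.smult_assoc)
    finally have "u \<odot>\<^bsub>M\<^esub> e = t \<odot>\<^bsub>M\<^esub> k"
      using u \<open>t \<in> carrier R\<close> kr(2) G'(2) k by simp
    then have "u \<odot>\<^bsub>M\<^esub> e \<in> K" using K kr(1) \<open>t \<in> carrier R\<close> by (simp add: M.submodule_iff)
    then have "b \<odot>\<^bsub>M\<^esub> (u \<odot>\<^bsub>M\<^esub> e) \<in> K" using K b(1) by (simp add: M.submodule_iff)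
    then have "e \<in> K" using b u G'(2) by (simp flip: M.smult_assoc)
    then have "G \<subseteq> K" using M.span_superset[of "G - {e}"] by (auto simp: K_def)
    then have "K = carrier M" using M.span_minimal[OF K, of G] G K by (auto simp: M.submodule_iff)
    then have "card G \<le> card (G - {e})" using min G'(1) G by (simp add: K_def)
    moreover have "card (G - {e}) < card G" using e G by (intro card_Diff1_less) auto
    ultimately have False by simp
    then show ?thesis ..
  qed
qed

text \<open>A finitely generated module annihilated by \<open>m\<close> is a finite-dimensional vector space over the
  residue field; each further generator adds at most one simple factor.\<close>

lemma finite_length_over_residue_field:
  assumes "local_ring R m" "left_module R M" "finitely_generated R M"
    and ann: "\<And>r x. r \<in> m \<Longrightarrow> x \<in> carrier M \<Longrightarrow> r \<odot>\<^bsub>M\<^esub> x = \<zero>\<^bsub>M\<^esub>"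
  shows "finite_length R M"
proof -
  interpret M: left_module R M by fact
  have "\<exists>\<rho>. rank_function R (M\<lparr>carrier := submodule_span R M G\<rparr>) \<rho>"
    if "finite G" "G \<subseteq> carrier M" for G
    using that
  proof (induction G)
    case empty
    then show ?case using M.rank_function_zero by (auto simp: M.span_empty)
  next
    case (insert e G)
    then have G: "G \<subseteq> carrier M" "e \<in> carrier M" by auto
    obtain \<rho> where \<rho>: "rank_function R (M\<lparr>carrier := submodule_span R M G\<rparr>) \<rho>"
      using insert by auto
    show ?case
    proof (rule M.rank_function_step[OF _ _ _ _ \<rho>])
      show "submodule (submodule_span R M G) R M"
        "submodule (submodule_span R M (insert e G)) R M"
        using G by (auto intro!: M.submodule_submodule_span)
      show "submodule_span R M G \<subseteq> submodule_span R M (insert e G)"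
        by (auto simp: submodule_span_def)
      show "\<not> (\<exists>K. submodule K R M \<and> submodule_span R M G \<subset> K \<and>
        K \<subset> submodule_span R M (insert e G))"
      proof (intro notI, elim exE conjE)
        fix K assume K: "submodule K R M" "submodule_span R M G \<subset> K"
          "K \<subset> submodule_span R M (insert e G)"
        then obtain y where y: "y \<in> K" "y \<notin> submodule_span R M G" by blast
        then obtain k a where ka: "k \<in> submodule_span R M G" "a \<in> carrier R"
          "y = k \<oplus>\<^bsub>M\<^esub> a \<odot>\<^bsub>M\<^esub> e"
          using K(3) M.span_insert[OF G] by blast
        have k: "k \<in> K" "k \<in> carrier M" using ka(1) K by (auto simp: M.submodule_iff)
        have "a \<notin> m" using y(2) ka ann[of a e] G(2) k(2) by auto
        then obtain b where b: "b \<in> carrier R" "b \<otimes>\<^bsub>R\<^esub> a = \<one>\<^bsub>R\<^esub>"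
          using local_ring_Units[OF assms(1) ka(2)] by blast
        have "y \<ominus>\<^bsub>M\<^esub> k \<in> K" using M.submodule_minus[OF K(1) y(1) k(1)] .
        moreover have "y \<ominus>\<^bsub>M\<^esub> k = a \<odot>\<^bsub>M\<^esub> e"
          using ka k G by (simp add: M.M.minus_eq M.M.a_ac M.M.r_neg1 M.M.r_neg2)
        ultimately have "b \<odot>\<^bsub>M\<^esub> (a \<odot>\<^bsub>M\<^esub> e) \<in> K" using K(1) b(1) by (simp add: M.submodule_iff)
        then have "e \<in> K" using b ka(2) G(2) by (simp flip: M.smult_assoc)
        then have "insert e G \<subseteq> K" using M.span_superset[of G] K(2) by auto
        then show False using M.span_minimal[OF K(1)] K(3) by blast
      qed
    qed
  qed
  moreover obtain G where "finite G" "G \<subseteq> carrier M" "submodule_span R M G = carrier M"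
    using assms(3) by (auto simp: M.finitely_generated_iff_span)
  ultimately have "\<exists>\<rho>. rank_function R (M\<lparr>carrier := carrier M\<rparr>) \<rho>" by metis
  then show ?thesis by (simp add: M.finite_length_iff_rank M.rank_function_carrier)
qed

lemma restrict_scalars_simps [simp]:
  "carrier (restrict_scalars \<phi> M) = carrier M" "\<zero>\<^bsub>restrict_scalars \<phi> M\<^esub> = \<zero>\<^bsub>M\<^esub>"
  "x \<oplus>\<^bsub>restrict_scalars \<phi> M\<^esub> y = x \<oplus>\<^bsub>M\<^esub> y" "r \<odot>\<^bsub>restrict_scalars \<phi> M\<^esub> x = \<phi> r \<odot>\<^bsub>M\<^esub> x"
  by (simp_all add: restrict_scalars_def)

lemma regular_module_simps [simp]:
  "carrier (regular_module L) = carrier L" "\<zero>\<^bsub>regular_module L\<^esub> = \<zero>\<^bsub>L\<^esub>"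
  "x \<oplus>\<^bsub>regular_module L\<^esub> y = x \<oplus>\<^bsub>L\<^esub> y" "a \<odot>\<^bsub>regular_module L\<^esub> x = a \<otimes>\<^bsub>L\<^esub> x"
  by (simp_all add: regular_module_def)

lemma left_module_regular_module:
  assumes "ring L"
  shows "left_module L (regular_module L)"
proof -
  interpret L: ring L by fact
  have "abelian_group (regular_module L)"
    by (rule abelian_group_same[OF L.abelian_group_axioms]) (simp_all add: regular_module_def)
  then show ?thesis
    by (intro left_module.intro left_module_axioms.intro assms)
       (auto simp: L.l_distr L.r_distr L.m_assoc)
qed

text \<open>The products \<open>g s\<close> of the generators \<open>g\<close> of \<open>\<Lambda>\<close> over \<open>R\<close> and \<open>s\<close> of \<open>M\<close> over \<open>\<Lambda>\<close>
  generate \<open>M\<close> over \<open>R\<close>.\<close>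

lemma finitely_generated_restrict_scalars:
  assumes "ring R" "module_finite_algebra R L \<phi>" "left_module L M" "finitely_generated L M"
  shows "finitely_generated R (restrict_scalars \<phi> M)"
proof -
  interpret M: left_module L M by fact
  have \<phi>: "\<phi> \<in> ring_hom R L" using assms(2) by (simp add: module_finite_algebra_def)
  interpret RM: left_module R "restrict_scalars \<phi> M"
    by (rule restrict_scalars_left_module[OF assms(1) \<phi> assms(3)])
  interpret RL: left_module R "restrict_scalars \<phi> (regular_module L)"
    by (rule restrict_scalars_left_module[OF assms(1) \<phi> left_module_regular_module])
       (rule M.R.ring_axioms)
  obtain G where G: "finite G" "G \<subseteq> carrier L"
    "submodule_span R (restrict_scalars \<phi> (regular_module L)) G = carrier L"
    using assms(2) by (auto simp: module_finite_algebra_def RL.finitely_generated_iff_span)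
  obtain S where S: "finite S" "S \<subseteq> carrier M" "submodule_span L M S = carrier M"
    using assms(4) by (auto simp: M.finitely_generated_iff_span)
  define E where "E = (\<lambda>(g, s). g \<odot>\<^bsub>M\<^esub> s) ` (G \<times> S)"
  define K where "K = submodule_span R (restrict_scalars \<phi> M) E"
  have E: "finite E" "E \<subseteq> carrier M" using G S by (auto simp: E_def)
  have K: "submodule K R (restrict_scalars \<phi> M)"
    unfolding K_def by (rule RM.submodule_submodule_span) (use E in simp)
  note \<phi>c = ring_hom_closed[OF \<phi>]
  have GS: "a \<odot>\<^bsub>M\<^esub> s \<in> K" if "a \<in> carrier L" "s \<in> S" for a s
  proof -
    have s: "s \<in> carrier M" using that S by blast
    have "submodule {a \<in> carrier L. a \<odot>\<^bsub>M\<^esub> s \<in> K} R (restrict_scalars \<phi> (regular_module L))"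
      using K s by (auto simp: RL.submodule_iff RM.submodule_iff M.smult_l_distr M.smult_l_null
          M.smult_assoc \<phi>c)
    moreover have "G \<subseteq> {a \<in> carrier L. a \<odot>\<^bsub>M\<^esub> s \<in> K}"
      using G(2) that(2) RM.span_superset[of E] by (auto simp: K_def E_def)
    ultimately show ?thesis using RL.span_minimal G(3) that(1) by blast
  qed
  have "submodule {x \<in> carrier M. \<forall>a\<in>carrier L. a \<odot>\<^bsub>M\<^esub> x \<in> K} L M"
    using K by (auto simp: M.submodule_iff RM.submodule_iff M.smult_r_distr M.smult_r_null
        simp flip: M.smult_assoc)
  moreover have "S \<subseteq> {x \<in> carrier M. \<forall>a\<in>carrier L. a \<odot>\<^bsub>M\<^esub> x \<in> K}" using S GS by auto
  ultimately have "carrier M \<subseteq> {x \<in> carrier M. \<forall>a\<in>carrier L. a \<odot>\<^bsub>M\<^esub> x \<in> K}"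
    using M.span_minimal S(3) by blast
  then have "carrier M \<subseteq> K" using M.smult_one M.R.one_closed by fastforce
  then have "K = carrier M" using K by (auto simp: RM.submodule_iff)
  then show ?thesis
    unfolding RM.finitely_generated_iff_span using E by (auto simp: K_def)
qed

lemma fg_mod_mod_le_fl_mod:
  assumes "local_ring R m" "module_finite_algebra R L \<phi>"
  shows "fg_mod_mod L \<phi> m \<subseteq> fl_mod L"
proof
  fix M assume "M \<in> fg_mod_mod L \<phi> m"
  then have M: "left_module L M" "finitely_generated L M"
    and ann: "\<And>r x. r \<in> m \<Longrightarrow> x \<in> carrier M \<Longrightarrow> \<phi> r \<odot>\<^bsub>M\<^esub> x = \<zero>\<^bsub>M\<^esub>"
    by (auto simp: fg_mod_mod_def fg_mod_def)
  interpret M: left_module L M by fact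
  interpret R: cring R using assms(1) by (simp add: local_ring_def)
  have \<phi>: "\<phi> \<in> ring_hom R L" using assms(2) by (simp add: module_finite_algebra_def)
  interpret RM: left_module R "restrict_scalars \<phi> M"
    by (rule restrict_scalars_left_module[OF R.ring_axioms \<phi> M(1)])
  have "finite_length R (restrict_scalars \<phi> M)"
    by (rule finite_length_over_residue_field[OF assms(1) RM.left_module_axioms])
       (use finitely_generated_restrict_scalars[OF R.ring_axioms assms(2) M] ann in auto)
  then obtain \<rho> where \<rho>: "rank_function R (restrict_scalars \<phi> M) \<rho>"
    by (auto simp: RM.finite_length_iff_rank)
  have "submodule A R (restrict_scalars \<phi> M)" if "submodule A L M" for A
    using that ring_hom_closed[OF \<phi>] by (auto simp: M.submodule_iff RM.submodule_iff)
  then have "rank_function L M \<rho>" using \<rho> by (auto simp: rank_function_def)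
  then show "M \<in> fl_mod L" using M(1) by (auto simp: fl_mod_def M.finite_length_iff_rank)
qed

text \<open>The key step; the reason is given at the beginning. The image of \<open>g\<close> is chosen of least rank
  among the images of all non-zero homomorphisms.\<close>

lemma nonzero_hom_with_annihilated_image:
  assumes "local_ring R m" "module_finite_algebra R L \<phi>"
    and "left_module L X" "left_module L Y" "finite_length L Y"
    and f: "f \<in> module_hom L X Y" "x\<^sub>0 \<in> carrier X" "f x\<^sub>0 \<noteq> \<zero>\<^bsub>Y\<^esub>"
  shows "\<exists>g\<in>module_hom L X Y. (\<exists>x\<in>carrier X. g x \<noteq> \<zero>\<^bsub>Y\<^esub>) \<and>
    (\<forall>r\<in>m. \<forall>x\<in>carrier X. \<phi> r \<odot>\<^bsub>Y\<^esub> g x = \<zero>\<^bsub>Y\<^esub>)"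
proof -
  interpret X: left_module L X by fact
  interpret Y: left_module L Y by fact
  interpret R: cring R using assms(1) by (simp add: local_ring_def)
  interpret m: maximalideal m R using assms(1) by (simp add: local_ring_def)
  have \<phi>: "\<phi> \<in> ring_hom R L"
    and central: "\<And>r a. r \<in> carrier R \<Longrightarrow> a \<in> carrier L \<Longrightarrow> \<phi> r \<otimes>\<^bsub>L\<^esub> a = a \<otimes>\<^bsub>L\<^esub> \<phi> r"
    using assms(2) by (auto simp: module_finite_algebra_def)
  obtain \<rho> where \<rho>: "rank_function L Y \<rho>" using assms(5) by (auto simp: Y.finite_length_iff_rank)
  let ?P = "\<lambda>g. g \<in> module_hom L X Y \<and> (\<exists>x\<in>carrier X. g x \<noteq> \<zero>\<^bsub>Y\<^esub>)"
  have "?P f" using f by blast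
  then have "\<exists>g. ?P g \<and> (\<forall>h. ?P h \<longrightarrow> \<rho> (g ` carrier X) \<le> \<rho> (h ` carrier X))"
    by (rule ex_has_least_nat[where m = "\<lambda>g. \<rho> (g ` carrier X)"])
  then obtain g where gg: "?P g \<and> (\<forall>h. ?P h \<longrightarrow> \<rho> (g ` carrier X) \<le> \<rho> (h ` carrier X))"
    by (rule exE)
  note min = mp[OF spec[OF conjunct2[OF gg]]]
  have g: "g \<in> module_hom L X Y" "\<exists>x\<in>carrier X. g x \<noteq> \<zero>\<^bsub>Y\<^esub>" using conjunct1[OF gg] by auto
  note gD = module_homD[OF g(1)]
  define Z where "Z = g ` carrier X"
  have Z: "submodule Z L Y"
    unfolding Z_def by (rule submodule_image[OF assms(3,4) g(1) X.submodule_carrier])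
  interpret Z: left_module L "Y\<lparr>carrier := Z\<rparr>" by (rule Y.submodule_left_module[OF Z])
  have fgZ: "finitely_generated L (Y\<lparr>carrier := Z\<rparr>)"
    by (rule Z.finite_length_imp_finitely_generated[OF Y.finite_length_submodule[OF assms(5) Z]])
  have "\<phi> t \<odot>\<^bsub>Y\<^esub> g x = \<zero>\<^bsub>Y\<^esub>" if t: "t \<in> m" and x: "x \<in> carrier X" for t x
  proof (rule ccontr)
    assume nz: "\<phi> t \<odot>\<^bsub>Y\<^esub> g x \<noteq> \<zero>\<^bsub>Y\<^esub>"
    have tR: "t \<in> carrier R" using t m.a_subset by blast
    have tL: "\<phi> t \<in> carrier L" by (rule ring_hom_closed[OF \<phi> tR])
    define h where "h x = \<phi> t \<odot>\<^bsub>Y\<^esub> g x" for x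
    have h: "h \<in> module_hom L X Y"
      by (auto simp: module_hom_def h_def gD tL Y.smult_r_distr central[OF tR]
          simp flip: Y.smult_assoc)
    have nz': "h x \<noteq> \<zero>\<^bsub>Y\<^esub>" using nz by (simp add: h_def)
    have sub: "h ` carrier X \<subseteq> Z"
      using Z tL by (auto simp: h_def Y.submodule_iff) (simp add: Z_def)
    have "\<rho> Z \<le> \<rho> (h ` carrier X)" unfolding Z_def by (rule min) (use h nz' x in blast)
    then have "\<not> h ` carrier X \<subset> Z"
      using \<rho> Z submodule_image[OF assms(3,4) h X.submodule_carrier]
      by (auto simp: rank_function_def simp flip: not_less)
    then have "h ` carrier X = Z" using sub by blast
    then have div: "\<exists>y\<in>Z. z = \<phi> t \<odot>\<^bsub>Y\<^esub> y" if "z \<in> Z" for z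
      using that by (auto simp: h_def Z_def)
    have "carrier (restrict_scalars \<phi> (Y\<lparr>carrier := Z\<rparr>)) =
        {\<zero>\<^bsub>restrict_scalars \<phi> (Y\<lparr>carrier := Z\<rparr>)\<^esub>}"
    proof (rule nakayama_local[OF assms(1) _ _ t])
      show "left_module R (restrict_scalars \<phi> (Y\<lparr>carrier := Z\<rparr>))"
        by (rule restrict_scalars_left_module[OF R.ring_axioms \<phi> Z.left_module_axioms])
      show "finitely_generated R (restrict_scalars \<phi> (Y\<lparr>carrier := Z\<rparr>))"
        by (rule finitely_generated_restrict_scalars[OF R.ring_axioms assms(2)
              Z.left_module_axioms fgZ])
    qed (use div in auto)
    then show False using g(2) by (auto simp: Z_def)
  qed
  then show ?thesis using g by blast
qed

section \<open>Torsion pairs\<close>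

text \<open>The condition \<open>Hom(X, Y) = 0\<close>. Homomorphisms are functions on the whole type, so they are
  required to vanish on the carrier of \<open>X\<close> only.\<close>

definition hom_vanishes ::
  "('l, 'c) ring_scheme \<Rightarrow> ('l, 'u, 'd) module_scheme \<Rightarrow> ('l, 'v, 'e) module_scheme \<Rightarrow> bool"
  where "hom_vanishes L X Y \<longleftrightarrow> (\<forall>f\<in>module_hom L X Y. \<forall>x\<in>carrier X. f x = \<zero>\<^bsub>Y\<^esub>)"

lemma hom_vanishes_image:
  assumes "hom_vanishes L X Y" "p \<in> module_hom L X Z" "p ` carrier X = carrier Z"
  shows "hom_vanishes L Z Y"
  unfolding hom_vanishes_def
proof (intro ballI)
  fix f z assume f: "f \<in> module_hom L Z Y" and "z \<in> carrier Z"
  then obtain x where "x \<in> carrier X" "z = p x" using assms(3) by auto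
  then show "f z = \<zero>\<^bsub>Y\<^esub>"
    using assms(1) module_hom_compose[OF assms(2) f] by (auto simp: hom_vanishes_def)
qed

lemma hom_vanishes_iso_right:
  assumes "left_module L Y" "left_module L Z" "hom_vanishes L X Y" "module_iso L Y Z"
  shows "hom_vanishes L X Z"
  unfolding hom_vanishes_def
proof (intro ballI)
  fix f x assume f: "f \<in> module_hom L X Z" and x: "x \<in> carrier X"
  obtain g where g: "g \<in> module_hom L Z Y" "bij_betw g (carrier Z) (carrier Y)"
    using module_iso_sym[OF assms(1,4)] by (auto simp: module_iso_def)
  interpret Z: left_module L Z by fact
  have "g (f x) = g \<zero>\<^bsub>Z\<^esub>"
    using assms(3) module_hom_compose[OF f g(1)] x module_hom_zero[OF assms(2,1) g(1)]
    by (auto simp: hom_vanishes_def)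
  then show "f x = \<zero>\<^bsub>Z\<^esub>"
    using g(2) module_homD(1)[OF f x] by (auto simp: bij_betw_def dest: inj_onD)
qed

lemma torsion_class_iff:
  assumes "torsion_pair L A T F" and A: "\<And>X. X \<in> A \<Longrightarrow> left_module L X" and X: "X \<in> A"
  shows "X \<in> T \<longleftrightarrow> (\<forall>Y\<in>F. hom_vanishes L X Y)"
proof
  assume "X \<in> T"
  then show "\<forall>Y\<in>F. hom_vanishes L X Y"
    using assms(1) by (auto simp: torsion_pair_def hom_vanishes_def)
next
  assume van: "\<forall>Y\<in>F. hom_vanishes L X Y"
  obtain X' X'' f g where X': "X' \<in> T" "X'' \<in> F" and ex: "short_exact L X' X X'' f g"
    using assms(1) X unfolding torsion_pair_def by blast
  have "\<forall>x\<in>carrier X. g x = \<zero>\<^bsub>X''\<^esub>"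
    using van X'(2) ex by (auto simp: hom_vanishes_def short_exact_def)
  then have "f ` carrier X' = carrier X" using ex by (auto simp: short_exact_def a_kernel_def')
  then have "module_iso L X' X"
    using ex by (auto simp: module_iso_def short_exact_def bij_betw_def)
  then show "X \<in> T" using assms(1) X' X by (auto simp: torsion_pair_def iso_closed_in_def)
qed

lemma image_in_fg_mod_mod:
  fixes Y :: "('l, 'u) module"
  assumes "left_module L X" "Y \<in> fl_mod L" "g \<in> module_hom L X Y"
    and "\<And>r x. r \<in> m \<Longrightarrow> x \<in> carrier X \<Longrightarrow> \<phi> r \<odot>\<^bsub>Y\<^esub> g x = \<zero>\<^bsub>Y\<^esub>"
  shows "Y\<lparr>carrier := g ` carrier X\<rparr> \<in> fg_mod_mod L \<phi> m"
proof -
  have Y: "left_module L Y" "finite_length L Y" using assms(2) by (auto simp: fl_mod_def)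
  interpret X: left_module L X by fact
  interpret Y: left_module L Y by fact
  have Z: "submodule (g ` carrier X) L Y"
    by (rule submodule_image[OF assms(1) Y(1) assms(3) X.submodule_carrier])
  interpret Z: left_module L "Y\<lparr>carrier := g ` carrier X\<rparr>" by (rule Y.submodule_left_module[OF Z])
  show ?thesis
    using Z.finite_length_imp_finitely_generated[OF Y.finite_length_submodule[OF Y(2) Z]]
      Z.left_module_axioms assms(4)
    by (auto simp: fg_mod_mod_def fg_mod_def)
qed

lemma torsion_pair_restrict:
  fixes L :: "('l, 'd) ring_scheme" and T F :: "('l, 'u) module set"
  assumes "local_ring R m" "module_finite_algebra R L \<phi>" "torsion_pair L (fl_mod L) T F"
  shows "torsion_pair L (fg_mod_mod L \<phi> m) (T \<inter> fg_mod_mod L \<phi> m) (F \<inter> fg_mod_mod L \<phi> m)"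
proof -
  let ?A = "fg_mod_mod L \<phi> m :: ('l, 'u) module set"
  note le = fg_mod_mod_le_fl_mod[OF assms(1,2)]
  interpret m: maximalideal m R using assms(1) by (simp add: local_ring_def)
  have \<phi>: "\<phi> \<in> ring_hom R L" using assms(2) by (simp add: module_finite_algebra_def)
  have phic: "\<phi> r \<in> carrier L" if "r \<in> m" for r using ring_hom_closed[OF \<phi>] m.a_subset that by blast
  have "\<exists>X'\<in>T \<inter> ?A. \<exists>X''\<in>F \<inter> ?A. \<exists>f g. short_exact L X' X X'' f g" if X: "X \<in> ?A" for X
  proof -
    obtain X' X'' f g where X': "X' \<in> T" "X'' \<in> F" and ex: "short_exact L X' X X'' f g"
      using assms(3) X le unfolding torsion_pair_def by blast
    have f: "f \<in> module_hom L X' X" "inj_on f (carrier X')"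
      and g: "g \<in> module_hom L X X''" "g ` carrier X = carrier X''"
      using ex by (auto simp: short_exact_def)
    have fl: "X' \<in> fl_mod L" "X'' \<in> fl_mod L"
      using X' assms(3) by (auto simp: torsion_pair_def iso_closed_in_def)
    then have lm: "left_module L X'" "left_module L X''" by (auto simp: fl_mod_def)
    have lX: "left_module L X" using X by (auto simp: fg_mod_mod_def fg_mod_def)
    have fg: "X' \<in> fg_mod L" "X'' \<in> fg_mod L"
      using fl left_module.finite_length_imp_finitely_generated
      by (auto simp: fl_mod_def fg_mod_def)
    have annX: "\<phi> r \<odot>\<^bsub>X\<^esub> x = \<zero>\<^bsub>X\<^esub>" if "r \<in> m" "x \<in> carrier X" for r x
      using X that by (auto simp: fg_mod_mod_def)
    have "\<phi> r \<odot>\<^bsub>X'\<^esub> x = \<zero>\<^bsub>X'\<^esub>" if "r \<in> m" "x \<in> carrier X'" for r x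
    proof -
      interpret X': left_module L X' by (rule lm)
      have "f (\<phi> r \<odot>\<^bsub>X'\<^esub> x) = f \<zero>\<^bsub>X'\<^esub>"
        using module_homD[OF f(1)] that phic annX module_hom_zero[OF lm(1) lX f(1)] by simp
      then show ?thesis using f(2) that phic by (auto dest: inj_onD)
    qed
    moreover have "\<phi> r \<odot>\<^bsub>X''\<^esub> y = \<zero>\<^bsub>X''\<^esub>" if "r \<in> m" "y \<in> carrier X''" for r y
    proof -
      obtain x where "x \<in> carrier X" "y = g x" using g(2) \<open>y \<in> carrier X''\<close> by auto
      then show ?thesis
        using module_homD(3)[OF g(1), of "\<phi> r" x] \<open>r \<in> m\<close> phic annX module_hom_zero[OF lX lm(2) g(1)]
        by simp
    qed
    ultimately have "X' \<in> T \<inter> ?A" "X'' \<in> F \<inter> ?A" using X' fg by (auto simp: fg_mod_mod_def)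
    then show ?thesis using ex by blast
  qed
  moreover have "iso_closed_in L ?A (T \<inter> ?A)" "iso_closed_in L ?A (F \<inter> ?A)"
    using assms(3) le by (auto simp: torsion_pair_def iso_closed_in_def)
  ultimately show ?thesis using assms(3) by (auto simp: torsion_pair_def)
qed

text \<open>A torsion class of \<open>fl \<Lambda>\<close> is determined, even as regards inclusion, by its modules that are
  annihilated by \<open>m\<close>.\<close>

lemma torsion_class_le:
  assumes "local_ring R m" "module_finite_algebra R L \<phi>"
    and "torsion_pair L (fl_mod L) T\<^sub>1 F\<^sub>1" "torsion_pair L (fl_mod L) T\<^sub>2 F\<^sub>2"
    and le: "T\<^sub>1 \<inter> fg_mod_mod L \<phi> m \<subseteq> T\<^sub>2"
  shows "T\<^sub>1 \<subseteq> T\<^sub>2"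
proof
  fix X assume X1: "X \<in> T\<^sub>1"
  have fl: "left_module L Y" if "Y \<in> fl_mod L" for Y using that by (auto simp: fl_mod_def)
  have X: "X \<in> fl_mod L" using X1 assms(3) by (auto simp: torsion_pair_def iso_closed_in_def)
  have "hom_vanishes L X Y" if "Y \<in> F\<^sub>2" for Y
  proof (rule ccontr)
    assume "\<not> ?thesis"
    then obtain f x\<^sub>0 where f: "f \<in> module_hom L X Y" "x\<^sub>0 \<in> carrier X" "f x\<^sub>0 \<noteq> \<zero>\<^bsub>Y\<^esub>"
      by (auto simp: hom_vanishes_def)
    have Y: "Y \<in> fl_mod L" "finite_length L Y"
      using that assms(4) by (auto simp: torsion_pair_def iso_closed_in_def fl_mod_def)
    obtain g x where g: "g \<in> module_hom L X Y" "x \<in> carrier X" "g x \<noteq> \<zero>\<^bsub>Y\<^esub>"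
      and ann: "\<And>r x. r \<in> m \<Longrightarrow> x \<in> carrier X \<Longrightarrow> \<phi> r \<odot>\<^bsub>Y\<^esub> g x = \<zero>\<^bsub>Y\<^esub>"
      using nonzero_hom_with_annihilated_image[OF assms(1,2) fl[OF X] fl[OF Y(1)] Y(2) f] by blast
    let ?Z = "Y\<lparr>carrier := g ` carrier X\<rparr>"
    have Z: "?Z \<in> fg_mod_mod L \<phi> m"
      by (rule image_in_fg_mod_mod[where g = g and X = X]) (use fl X Y g ann in auto)
    then have Zfl: "?Z \<in> fl_mod L" using fg_mod_mod_le_fl_mod[OF assms(1,2)] by blast
    have "hom_vanishes L ?Z W" if "W \<in> F\<^sub>1" for W
    proof (rule hom_vanishes_image)
      show "hom_vanishes L X W" using torsion_class_iff[OF assms(3) fl X] X1 that by blast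
      show "g \<in> module_hom L X ?Z" by (rule module_hom_corestrict[OF g(1)]) simp
    qed simp
    then have "?Z \<in> T\<^sub>1" using torsion_class_iff[OF assms(3) fl Zfl] by blast
    then have "?Z \<in> T\<^sub>2" using Z le by blast
    then have "hom_vanishes L ?Z Y" using torsion_class_iff[OF assms(4) fl Zfl] that by blast
    moreover have "(\<lambda>y. y) \<in> module_hom L ?Z Y"
      by (rule module_hom_inclusion) (use module_homD(1)[OF g(1)] in auto)
    ultimately show False using g by (auto simp: hom_vanishes_def)
  qed
  then show "X \<in> T\<^sub>2" using torsion_class_iff[OF assms(4) fl X] by blast
qed

text \<open>Every torsion pair of \<open>mod (\<Lambda>/m\<Lambda>)\<close> comes from a torsion pair of \<open>fl \<Lambda>\<close>.\<close>

lemma torsion_pair_extend: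
  fixes L :: "('l, 'd) ring_scheme" and T :: "('l, 'u) module set"
  assumes "local_ring R m" "module_finite_algebra R L \<phi>" "torsion_pair L (fg_mod_mod L \<phi> m) T F"
  shows "torsion_pair L (fl_mod L :: ('l, 'u) module set) {X \<in> fl_mod L. \<forall>Y\<in>F. hom_vanishes L X Y}
    {Y \<in> fl_mod L. \<forall>X\<in>T. hom_vanishes L X Y}"
    (is "torsion_pair L ?A ?T ?F")
proof -
  have fl: "left_module L Y" if "Y \<in> fl_mod L" for Y :: "('l, 'u) module"
    using that by (auto simp: fl_mod_def)
  have lm: "left_module L Y" if "Y \<in> fg_mod_mod L \<phi> m" for Y :: "('l, 'u) module"
    using that by (auto simp: fg_mod_mod_def fg_mod_def)
  have TF: "T \<subseteq> fg_mod_mod L \<phi> m" "F \<subseteq> fg_mod_mod L \<phi> m"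
    using assms(3) by (auto simp: torsion_pair_def iso_closed_in_def)
  have orth: "hom_vanishes L X Y" if "X \<in> T" "Y \<in> F" for X Y
    using assms(3) that by (auto simp: torsion_pair_def hom_vanishes_def)
  note le = fg_mod_mod_le_fl_mod[OF assms(1,2)]
  have "iso_closed_in L ?A ?T"
    unfolding iso_closed_in_def
  proof (intro conjI ballI impI)
    fix X Y assume X: "X \<in> ?T" and Y: "Y \<in> ?A" and iso: "module_iso L X Y"
    from iso obtain p where "p \<in> module_hom L X Y" "p ` carrier X = carrier Y"
      by (auto simp: module_iso_def bij_betw_def)
    then have "\<forall>W\<in>F. hom_vanishes L Y W" using X hom_vanishes_image by blast
    then show "Y \<in> ?T" using Y by blast
  qed blast
  moreover have "iso_closed_in L ?A ?F"
    unfolding iso_closed_in_def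
  proof (intro conjI ballI impI)
    fix Y Z assume Y: "Y \<in> ?F" and Z: "Z \<in> ?A" and iso: "module_iso L Y Z"
    have "hom_vanishes L X Z" if "X \<in> T" for X
      by (rule hom_vanishes_iso_right[OF _ fl[OF Z] _ iso]) (use Y that fl in auto)
    then show "Z \<in> ?F" using Z by simp
  qed blast
  moreover have "hom_vanishes L X Y" if X: "X \<in> ?T" and Y: "Y \<in> ?F" for X Y
  proof (rule ccontr)
    assume "\<not> ?thesis"
    then obtain f x\<^sub>0 where f: "f \<in> module_hom L X Y" "x\<^sub>0 \<in> carrier X" "f x\<^sub>0 \<noteq> \<zero>\<^bsub>Y\<^esub>"
      by (auto simp: hom_vanishes_def)
    have XY: "left_module L X" "left_module L Y" "finite_length L Y"
      using X Y by (auto simp: fl_mod_def)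
    obtain g x where g: "g \<in> module_hom L X Y" "x \<in> carrier X" "g x \<noteq> \<zero>\<^bsub>Y\<^esub>"
      and ann: "\<And>r x. r \<in> m \<Longrightarrow> x \<in> carrier X \<Longrightarrow> \<phi> r \<odot>\<^bsub>Y\<^esub> g x = \<zero>\<^bsub>Y\<^esub>"
      using nonzero_hom_with_annihilated_image[OF assms(1,2) XY f] by blast
    let ?Z = "Y\<lparr>carrier := g ` carrier X\<rparr>"
    have Z: "?Z \<in> fg_mod_mod L \<phi> m"
      by (rule image_in_fg_mod_mod[where g = g and X = X]) (use XY Y g ann in auto)
    have "hom_vanishes L ?Z W" if "W \<in> F" for W
    proof (rule hom_vanishes_image)
      show "hom_vanishes L X W" using X that by blast
      show "g \<in> module_hom L X ?Z" by (rule module_hom_corestrict[OF g(1)]) simp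
    qed simp
    then have "?Z \<in> T" using torsion_class_iff[OF assms(3) lm Z] by blast
    then have "hom_vanishes L ?Z Y" using Y by blast
    moreover have "(\<lambda>y. y) \<in> module_hom L ?Z Y"
      by (rule module_hom_inclusion) (use module_homD(1)[OF g(1)] in auto)
    ultimately show False using g by (auto simp: hom_vanishes_def)
  qed
  moreover have "\<exists>X'\<in>?T. \<exists>X''\<in>?F. \<exists>f g. short_exact L X' X X'' f g" if X: "X \<in> ?A" for X
  proof -
    have XL: "left_module L X" "finite_length L X" using X by (auto simp: fl_mod_def)
    interpret X: left_module L X by (rule XL)
    \<comment> \<open>\<open>U\<close> is the sum of the members of \<open>\<V>\<close>. A homomorphism from \<open>U\<close> to an object of \<open>F\<close>
      vanishes on each of them, so its kernel, a submodule, is all of \<open>U\<close>.\<close>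
    define \<V> where "\<V> = {V. submodule V L X \<and> (\<forall>Y\<in>F. hom_vanishes L (X\<lparr>carrier := V\<rparr>) Y)}"
    define U where "U = submodule_span L X (\<Union>\<V>)"
    have \<V>c: "\<Union>\<V> \<subseteq> carrier X" by (auto simp: \<V>_def X.submodule_iff)
    have U: "submodule U L X" unfolding U_def by (rule X.submodule_submodule_span[OF \<V>c])
    have Uc: "U \<subseteq> carrier X" using U by (simp add: X.submodule_iff)
    have \<V>U: "V \<subseteq> U" if "V \<in> \<V>" for V using that X.span_superset[of "\<Union>\<V>"] by (auto simp: U_def)
    have UL: "left_module L (X\<lparr>carrier := U\<rparr>)" by (rule X.submodule_left_module[OF U])
    have Uvan: "hom_vanishes L (X\<lparr>carrier := U\<rparr>) Y" if Y: "Y \<in> F" for Y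
      unfolding hom_vanishes_def
    proof (intro ballI)
      fix f x assume f: "f \<in> module_hom L (X\<lparr>carrier := U\<rparr>) Y" and x: "x \<in> carrier (X\<lparr>carrier := U\<rparr>)"
      have YL: "left_module L Y" using Y TF lm by blast
      interpret Y: left_module L Y by (rule YL)
      have "submodule {x \<in> carrier (X\<lparr>carrier := U\<rparr>). f x \<in> {\<zero>\<^bsub>Y\<^esub>}} L (X\<lparr>carrier := U\<rparr>)"
        by (rule submodule_vimage[OF UL YL f Y.submodule_zero])
      then have ker: "submodule {x \<in> U. f x = \<zero>\<^bsub>Y\<^esub>} L X" by (simp add: X.submodule_trans_iff[OF U])
      have "\<Union>\<V> \<subseteq> {x \<in> U. f x = \<zero>\<^bsub>Y\<^esub>}"
      proof
        fix v assume "v \<in> \<Union>\<V>"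
        then obtain V where V: "V \<in> \<V>" "v \<in> V" by blast
        have "f \<in> module_hom L (X\<lparr>carrier := U\<rparr>\<lparr>carrier := V\<rparr>) Y"
          by (rule module_hom_restrict[OF f]) (use \<V>U V in auto)
        then have "f v = \<zero>\<^bsub>Y\<^esub>" using V Y by (auto simp: \<V>_def hom_vanishes_def)
        then show "v \<in> {x \<in> U. f x = \<zero>\<^bsub>Y\<^esub>}" using \<V>U V by auto
      qed
      then show "f x = \<zero>\<^bsub>Y\<^esub>" using X.span_minimal[OF ker] x by (auto simp: U_def)
    qed
    have Ufl: "X\<lparr>carrier := U\<rparr> \<in> ?T"
      using Uvan UL X.finite_length_submodule[OF XL(2) U] by (auto simp: fl_mod_def)
    obtain Q :: "('l, 'u) module" and p where Q: "left_module L Q" and p: "p \<in> module_hom L X Q"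
      "p ` carrier X = carrier Q" "a_kernel X Q p = U"
      using quotient_module_exists[OF XL(1) U] by blast
    have pU: "p x = \<zero>\<^bsub>Q\<^esub> \<longleftrightarrow> x \<in> U" if "x \<in> carrier X" for x
      using p(3) that by (auto simp: a_kernel_def')
    have "hom_vanishes L W Q" if W: "W \<in> T" for W
    proof -
      have WL: "left_module L W" using W TF lm by blast
      interpret W: left_module L W by (rule WL)
      interpret Q: left_module L Q by (rule Q)
      have "h w = \<zero>\<^bsub>Q\<^esub>" if h: "h \<in> module_hom L W Q" and w: "w \<in> carrier W" for h w
      proof -
        note hD = module_homD[OF h] and pD = module_homD[OF p(1)]
        \<comment> \<open>\<open>V/U\<close> is the image of \<open>h\<close>. As \<open>Hom(U, F) = 0\<close>, a homomorphism \<open>f\<close> from \<open>V\<close> to an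
          object of \<open>F\<close> factors over \<open>V/U\<close>; its pullback along \<open>h\<close> starts in \<open>W \<in> T\<close>, so it is
          zero. Hence \<open>V\<close> belongs to \<open>\<V>\<close>, and \<open>V = U\<close>.\<close>
        define V where "V = {x \<in> carrier X. p x \<in> h ` carrier W}"
        have V: "submodule V L X" unfolding V_def
          by (rule submodule_vimage[OF XL(1) Q p(1) submodule_image[OF WL Q h W.submodule_carrier]])
        have UV: "U \<subseteq> V"
        proof
          fix u assume u: "u \<in> U"
          then have "p u = h \<zero>\<^bsub>W\<^esub>" using pU Uc module_hom_zero[OF WL Q h] by auto
          then show "u \<in> V" using u Uc by (auto simp: V_def)
        qed
        have "hom_vanishes L (X\<lparr>carrier := V\<rparr>) Y" if Y: "Y \<in> F" for Y
          unfolding hom_vanishes_def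
        proof (intro ballI)
          fix f x assume f: "f \<in> module_hom L (X\<lparr>carrier := V\<rparr>) Y" and x: "x \<in> carrier (X\<lparr>carrier := V\<rparr>)"
          have YL: "left_module L Y" using Y TF lm by blast
          interpret Y: left_module L Y by (rule YL)
          note fD = module_homD[OF f, simplified]
          have fU: "f u = \<zero>\<^bsub>Y\<^esub>" if "u \<in> U" for u
          proof -
            have "f \<in> module_hom L (X\<lparr>carrier := V\<rparr>\<lparr>carrier := U\<rparr>) Y"
              by (rule module_hom_restrict[OF f]) (use UV in simp)
            then show ?thesis using Uvan[OF Y] that by (auto simp: hom_vanishes_def)
          qed
          have f_eq: "f a = f b" if ab: "a \<in> V" "b \<in> V" "p a = p b" for a b
          proof -
            have c: "a \<in> carrier X" "b \<in> carrier X" using ab by (auto simp: V_def)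
            have "p (a \<ominus>\<^bsub>X\<^esub> b) = \<zero>\<^bsub>Q\<^esub>"
              using module_hom_minus[OF XL(1) Q p(1) c] ab(3) pD(1)[OF c(2)]
              by (simp add: Q.M.minus_eq Q.M.r_neg)
            then have "a \<ominus>\<^bsub>X\<^esub> b \<in> U" using pU c by simp
            moreover from this have "f ((a \<ominus>\<^bsub>X\<^esub> b) \<oplus>\<^bsub>X\<^esub> b) = f (a \<ominus>\<^bsub>X\<^esub> b) \<oplus>\<^bsub>Y\<^esub> f b"
              using UV ab by (intro fD(2)) auto
            moreover have "(a \<ominus>\<^bsub>X\<^esub> b) \<oplus>\<^bsub>X\<^esub> b = a" using c by (simp add: X.M.minus_eq X.M.a_assoc X.M.l_neg)
            ultimately show ?thesis using fU fD(1)[OF ab(2)] by simp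
          qed
          \<comment> \<open>\<open>s\<close> lifts \<open>h\<close> to \<open>V\<close>. It need not be additive, but \<open>f \<circ> s\<close> is a homomorphism,
            because \<open>f\<close> is constant on the fibres of \<open>p\<close>.\<close>
          define s where "s w = (SOME x. x \<in> V \<and> p x = h w)" for w
          have s: "s w \<in> V \<and> p (s w) = h w" if w: "w \<in> carrier W" for w
          proof -
            obtain y where "y \<in> carrier X" "p y = h w" using hD(1)[OF w] p(2) by (metis imageE)
            then have "y \<in> V \<and> p y = h w" using w by (simp add: V_def)
            then show ?thesis unfolding s_def by (rule someI)
          qed
          have sc: "s w \<in> carrier X" if "w \<in> carrier W" for w using s[OF that] by (simp add: V_def)
          have Vadd: "a \<oplus>\<^bsub>X\<^esub> b \<in> V" if "a \<in> V" "b \<in> V" for a b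
            using V that by (simp add: X.submodule_iff)
          have Vsm: "c \<odot>\<^bsub>X\<^esub> a \<in> V" if "c \<in> carrier L" "a \<in> V" for a c
            using V that by (simp add: X.submodule_iff)
          have fs: "(\<lambda>w. f (s w)) \<in> module_hom L W Y"
          proof (unfold module_hom_def, safe)
            fix v w assume vw: "v \<in> carrier W" "w \<in> carrier W"
            have "f (s (v \<oplus>\<^bsub>W\<^esub> w)) = f (s v \<oplus>\<^bsub>X\<^esub> s w)"
              by (rule f_eq) (use s sc vw Vadd hD(2) pD(2) in simp_all)
            then show "f (s (v \<oplus>\<^bsub>W\<^esub> w)) = f (s v) \<oplus>\<^bsub>Y\<^esub> f (s w)" using fD(2) s vw by simp
          next
            fix c w assume cw: "c \<in> carrier L" "w \<in> carrier W"
            have "f (s (c \<odot>\<^bsub>W\<^esub> w)) = f (c \<odot>\<^bsub>X\<^esub> s w)"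
              by (rule f_eq) (use s sc cw Vsm hD(3) pD(3) in simp_all)
            then show "f (s (c \<odot>\<^bsub>W\<^esub> w)) = c \<odot>\<^bsub>Y\<^esub> f (s w)" using fD(3) s cw by simp
          qed (use fD(1) s in auto)
          obtain w where w: "w \<in> carrier W" "p x = h w" using x by (auto simp: V_def)
          then have "f x = f (s w)" using f_eq[of x "s w"] s[of w] x by simp
          also have "\<dots> = \<zero>\<^bsub>Y\<^esub>" using orth[OF W Y] fs w(1) by (auto simp: hom_vanishes_def)
          finally show "f x = \<zero>\<^bsub>Y\<^esub>" .
        qed
        then have "V \<subseteq> U" using V by (intro \<V>U) (auto simp: \<V>_def)
        obtain x where "x \<in> carrier X" "p x = h w" using hD(1)[OF w] p(2) by (metis imageE)
        moreover from this have "x \<in> U" using \<open>V \<subseteq> U\<close> w by (auto simp: V_def)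
        ultimately show ?thesis using pU by metis
      qed
      then show ?thesis by (auto simp: hom_vanishes_def)
    qed
    then have "Q \<in> ?F"
      using Q finite_length_image[OF XL(1) Q p(1,2) XL(2)] by (auto simp: fl_mod_def)
    moreover have "short_exact L (X\<lparr>carrier := U\<rparr>) X Q (\<lambda>x. x) p"
      using module_hom_inclusion[OF Uc] p by (auto simp: short_exact_def)
    ultimately show ?thesis using Ufl by blast
  qed
  ultimately show ?thesis unfolding torsion_pair_def hom_vanishes_def by blast
qed

theorem theorem1p6:
  fixes R :: "('r, 'c) ring_scheme" and L :: "('l, 'd) ring_scheme"
    and m :: "'r set" and \<phi> :: "'r \<Rightarrow> 'l"
  assumes "local_ring R m" and "noetherian_ring R"
    and "module_finite_algebra R L \<phi>"
  shows "bij_betw (\<lambda>T :: 'l small_module set. T \<inter> fg_mod_mod L \<phi> m)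
    (tors L (fl_mod L)) (tors L (fg_mod_mod L \<phi> m))"
  unfolding bij_betw_def
proof
  let ?A = "fg_mod_mod L \<phi> m :: 'l small_module set"
  show "inj_on (\<lambda>T. T \<inter> ?A) (tors L (fl_mod L))"
  proof (rule inj_onI)
    fix T\<^sub>1 T\<^sub>2 :: "'l small_module set"
    assume T: "T\<^sub>1 \<in> tors L (fl_mod L)" "T\<^sub>2 \<in> tors L (fl_mod L)" and eq: "T\<^sub>1 \<inter> ?A = T\<^sub>2 \<inter> ?A"
    obtain F\<^sub>1 F\<^sub>2 where F: "torsion_pair L (fl_mod L) T\<^sub>1 F\<^sub>1" "torsion_pair L (fl_mod L) T\<^sub>2 F\<^sub>2"
      using T by (auto simp: tors_def)
    show "T\<^sub>1 = T\<^sub>2"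
      using torsion_class_le[OF assms(1,3) F] torsion_class_le[OF assms(1,3) F(2,1)] eq by blast
  qed
  show "(\<lambda>T. T \<inter> ?A) ` tors L (fl_mod L) = tors L ?A"
  proof safe
    fix T :: "'l small_module set" assume "T \<in> tors L (fl_mod L)"
    then show "T \<inter> ?A \<in> tors L ?A"
      using torsion_pair_restrict[OF assms(1,3)] by (auto simp: tors_def)
  next
    fix T :: "'l small_module set" assume "T \<in> tors L ?A"
    then obtain F where F: "torsion_pair L ?A T F" by (auto simp: tors_def)
    let ?T = "{X \<in> fl_mod L. \<forall>Y\<in>F. hom_vanishes L X Y} :: 'l small_module set"
    have "?T \<in> tors L (fl_mod L)"
      using torsion_pair_extend[OF assms(1,3) F] by (auto simp: tors_def)
    moreover have "X \<in> T \<longleftrightarrow> (\<forall>Y\<in>F. hom_vanishes L X Y)" if "X \<in> ?A" for X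
      using torsion_class_iff[OF F _ that] by (auto simp: fg_mod_mod_def fg_mod_def)
    then have "T = ?T \<inter> ?A"
      using fg_mod_mod_le_fl_mod[OF assms(1,3)] F
      by (auto simp: torsion_pair_def iso_closed_in_def)
    ultimately show "T \<in> (\<lambda>T. T \<inter> ?A) ` tors L (fl_mod L)" by blast
  qed
qed

end
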